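(* Let $G^P$ be a metric on $B_i(M,\mathbb R^n)$ that is weaker than or at least as weak as a Sobolev $H^p$-metric with $p < \frac{\dim(M)}2+1$, i.e. there is a constant $C$ with $$\|h\|_{G^P} \leq C \|h\|_{H^p} = C \sqrt{\int_M \bar g\big( (1+\Delta^p) h,h \big)\, \mathrm{vol}(g)} \qquad \text{for all } h \in T\mathrm{Imm}.$$ Then the Fréchet distance cannot be bounded by the $G^P$-distance; that is, there is no constant $C'$ with $\mathrm{dist}^{B_i}_\infty(F_0,F_1)\le C'\,\mathrm{dist}^{B_i}_{G^P}(F_0,F_1)$ for all $F_0,F_1\in B_i(M,\mathbb R^n)$.
   Context: $M$ is a compact connected smooth manifold without boundary; $\mathbb R^n$ carries the Euclidean metric $\bar g$; $\mathrm{Imm}=\mathrm{Imm}(M,\mathbb R^n)$ is the Fréchet manifold of smooth immersions, assumed nonempty, $T_f\mathrm{Imm}=C^\infty(M,\mathbb R^n)$; $B_i=B_i(M,\mathbb R^n)=\mathrm{Imm}/\mathrm{Diff}(M)$ with projection $\pi:\mathrm{Imm}\to B_i$. For $f\in\mathrm{Imm}$: $g=f^*\bar g$, $\mathrm{vol}(g)$ is its volume density, $\Delta=\nabla^*\nabla$ is the (nonnegative) Bochner-Laplacian. Sobolev-type metric: $G^P_f(h,k)=\int_M\bar g(P_fh,k)\,\mathrm{vol}(g)$, $\|h\|_{G^P}=\sqrt{G^P(h,h)}$, where $P$ is a smooth section of $L(T\mathrm{Imm};T\mathrm{Imm})$ such that each $P_f$ is an elliptic pseudo-differential operator, symmetric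 and positive with respect to $\int_M\bar g(h,k)\,\mathrm{vol}(g)$, and $P$ is $\mathrm{Diff}(M)$-invariant ($P_f(h)\circ\varphi=P_{f\circ\varphi}(h\circ\varphi)$). It induces the unique metric on $B_i$ making $\pi$ a Riemannian submersion, and $\mathrm{dist}^{B_i}_{G^P}(F_0,F_1)$ is the infimum of the lengths $\int_0^1\sqrt{G^P_F(F_t,F_t)}\,dt$ of paths $F$ in $B_i$ from $F_0$ to $F_1$. Fréchet distance: $\mathrm{dist}^{B_i}_\infty(F_0,F_1)=\inf\{\|f_0-f_1\|_{L^\infty}: f_0,f_1\in\mathrm{Imm},\ \pi(f_0)=F_0,\ \pi(f_1)=F_1\}$. *)

theory Defs
  imports "HOL-Analysis.Analysis"
begin

section \<open>Smooth maps between open subsets of Euclidean spaces\<close>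

text \<open>Meaningful for open \<open>S\<close>; the derivatives of order \<open>k\<close> are taken as iterated directional
  derivatives in all directions.\<close>

primrec Ck_on :: "nat \<Rightarrow> 'a::euclidean_space set \<Rightarrow> ('a \<Rightarrow> 'b::real_normed_vector) \<Rightarrow> bool" where
  "Ck_on 0 S f \<longleftrightarrow> continuous_on S f"
| "Ck_on (Suc k) S f \<longleftrightarrow>
     f differentiable_on S \<and> (\<forall>v. Ck_on k S (\<lambda>x. frechet_derivative f (at x) v))"

definition smooth_on :: "'a::euclidean_space set \<Rightarrow> ('a \<Rightarrow> 'b::real_normed_vector) \<Rightarrow> bool" where
  "smooth_on S f \<longleftrightarrow> (\<forall>k. Ck_on k S f)"

definition dir_deriv ::
  "'a::euclidean_space \<Rightarrow> ('a \<Rightarrow> 'b::real_normed_vector) \<Rightarrow> 'a \<Rightarrow> 'b" where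
  "dir_deriv v f x = frechet_derivative f (at x) v"

definition test_function :: "'a::euclidean_space set \<Rightarrow> ('a \<Rightarrow> 'b::real_normed_vector) \<Rightarrow> bool" where
  "test_function V u \<longleftrightarrow>
     smooth_on UNIV u \<and> compact (closure {x. u x \<noteq> 0}) \<and> closure {x. u x \<noteq> 0} \<subseteq> V"


section \<open>Smooth manifolds\<close>

text \<open>The manifold is the whole type \<open>'p\<close>, equipped with a smooth atlas \<open>A\<close> modelled on
  \<open>real^'m\<close>; thus its dimension is \<open>CARD('m) \<ge> 1\<close>. A chart is a pair of its domain and its
  coordinate map. Hausdorffness is required through the type class \<open>t2_space\<close>; second countability
  is automatic for a compact manifold.\<close>

type_synonym ('p, 'm) chart = "'p set \<times> ('p \<Rightarrow> real^'m)"

definition cdom :: "('p, 'm) chart \<Rightarrow> 'p set" where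
  "cdom c = fst c"

definition coord :: "('p, 'm) chart \<Rightarrow> 'p \<Rightarrow> real^'m" where
  "coord c = snd c"

definition cimg :: "('p, 'm) chart \<Rightarrow> (real^'m) set" where
  "cimg c = coord c ` cdom c"

definition param :: "('p, 'm) chart \<Rightarrow> real^'m \<Rightarrow> 'p" where
  "param c = inv_into (cdom c) (coord c)"

definition is_chart :: "('p::topological_space, 'm::finite) chart \<Rightarrow> bool" where
  "is_chart c \<longleftrightarrow>
     open (cdom c) \<and> open (cimg c) \<and> homeomorphism (cdom c) (cimg c) (coord c) (param c)"

definition compatible :: "('p, 'm::finite) chart \<Rightarrow> ('p, 'm) chart \<Rightarrow> bool" where
  "compatible c d \<longleftrightarrow>
     smooth_on (coord c ` (cdom c \<inter> cdom d)) (coord d \<circ> param c) \<and>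
     smooth_on (coord d ` (cdom c \<inter> cdom d)) (coord c \<circ> param d)"

definition smooth_atlas :: "('p::topological_space, 'm::finite) chart set \<Rightarrow> bool" where
  "smooth_atlas A \<longleftrightarrow>
     (\<forall>c\<in>A. is_chart c) \<and> (\<forall>c\<in>A. \<forall>d\<in>A. compatible c d) \<and> (\<Union>c\<in>A. cdom c) = UNIV"

definition maximal_atlas ::
  "('p::topological_space, 'm::finite) chart set \<Rightarrow> ('p, 'm) chart set" where
  "maximal_atlas A = {c. is_chart c \<and> (\<forall>d\<in>A. compatible c d)}"

definition chart_at :: "('p, 'm) chart set \<Rightarrow> 'p \<Rightarrow> ('p, 'm) chart" where
  "chart_at A x = (SOME c. c \<in> A \<and> x \<in> cdom c)"

definition smooth_functions ::
  "('p, 'm::finite) chart set \<Rightarrow> ('p \<Rightarrow> 'b::real_normed_vector) set" where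
  "smooth_functions A = {f. \<forall>c\<in>A. smooth_on (cimg c) (f \<circ> param c)}"

text \<open>Families \<open>F t x\<close> smooth on \<open>\<real> \<times> M\<close>. By the exponential law these are
  exactly the smooth curves \<open>t \<mapsto> F t\<close> in the Frechet space of smooth functions on \<open>M\<close>.\<close>

definition smooth_curve ::
  "('p, 'm::finite) chart set \<Rightarrow> (real \<Rightarrow> 'p \<Rightarrow> 'b::real_normed_vector) \<Rightarrow> bool" where
  "smooth_curve A F \<longleftrightarrow>
     (\<forall>c\<in>A. smooth_on (UNIV \<times> cimg c) (\<lambda>(t, y). F t (param c y)))"

definition smooth_self_map ::
  "('p::topological_space, 'm::finite) chart set \<Rightarrow> ('p \<Rightarrow> 'p) \<Rightarrow> bool" where
  "smooth_self_map A \<phi> \<longleftrightarrow>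
     continuous_on UNIV \<phi> \<and>
     (\<forall>c\<in>A. \<forall>d\<in>A. smooth_on (coord c ` (cdom c \<inter> \<phi> -` cdom d)) (coord d \<circ> \<phi> \<circ> param c))"

definition Diff :: "('p::topological_space, 'm::finite) chart set \<Rightarrow> ('p \<Rightarrow> 'p) set" where
  "Diff A = {\<phi>. bij \<phi> \<and> smooth_self_map A \<phi> \<and> smooth_self_map A (inv \<phi>)}"

text \<open>Vector fields, as derivations of the algebra of smooth real functions.\<close>

definition vector_fields ::
  "('p, 'm::finite) chart set \<Rightarrow> (('p \<Rightarrow> real) \<Rightarrow> 'p \<Rightarrow> real) set" where
  "vector_fields A = {X.
     (\<forall>a\<in>smooth_functions A. X a \<in> smooth_functions A) \<and>
     (\<forall>a\<in>smooth_functions A. \<forall>b\<in>smooth_functions A. \<forall>r s.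
        X (\<lambda>x. r * a x + s * b x) = (\<lambda>x. r * X a x + s * X b x)) \<and>
     (\<forall>a\<in>smooth_functions A. \<forall>b\<in>smooth_functions A.
        X (\<lambda>x. a x * b x) = (\<lambda>x. X a x * b x + a x * X b x))}"


section \<open>Immersions and their induced geometry\<close>

definition Imm :: "('p, 'm::finite) chart set \<Rightarrow> ('p \<Rightarrow> real^'n) set" where
  "Imm A = {f \<in> smooth_functions A.
     \<forall>c\<in>A. \<forall>y\<in>cimg c. inj (frechet_derivative (f \<circ> param c) (at y))}"

text \<open>\<open>partial c i h x\<close> is the \<open>i\<close>-th coordinate derivative of \<open>h\<close> at \<open>x\<close> in the chart \<open>c\<close>.\<close>

definition partial :: "('p, 'm::finite) chart \<Rightarrow> 'm \<Rightarrow> ('p \<Rightarrow> real^'n) \<Rightarrow> 'p \<Rightarrow> real^'n" where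
  "partial c i h x = dir_deriv (axis i 1) (h \<circ> param c) (coord c x)"

definition pullback_metric ::
  "('p, 'm::finite) chart \<Rightarrow> ('p \<Rightarrow> real^'n) \<Rightarrow> 'p \<Rightarrow> real^'m^'m" where
  "pullback_metric c f x = (\<chi> i j. partial c i f x \<bullet> partial c j f x)"

definition is_vol ::
  "('p::topological_space, 'm::finite) chart set \<Rightarrow> ('p \<Rightarrow> real^'n) \<Rightarrow> 'p measure \<Rightarrow> bool" where
  "is_vol A f \<mu> \<longleftrightarrow> sets \<mu> = sets borel \<and>
     (\<forall>c\<in>A. \<forall>B\<in>sets borel. B \<subseteq> cdom c \<longrightarrow>
        emeasure \<mu> B =
          (\<integral>\<^sup>+y. ennreal (sqrt (det (pullback_metric c f (param c y)))) * indicator (coord c ` B) y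
             \<partial>lborel))"

definition vol :: "('p::topological_space, 'm::finite) chart set \<Rightarrow> ('p \<Rightarrow> real^'n) \<Rightarrow> 'p measure" where
  "vol A f = (THE \<mu>. is_vol A f \<mu>)"

definition L2_inner ::
  "('p::topological_space, 'm::finite) chart set \<Rightarrow> ('p \<Rightarrow> real^'n) \<Rightarrow>
   ('p \<Rightarrow> real^'n) \<Rightarrow> ('p \<Rightarrow> real^'n) \<Rightarrow> real" where
  "L2_inner A f h k = (\<integral>x. h x \<bullet> k x \<partial>vol A f)"

text \<open>On \<open>\<real>\<^sup>n\<close>-valued functions the covariant derivative is the differential. The following is
  the pointwise inner product of \<open>\<nabla>h\<close> and \<open>\<nabla>l\<close> induced by \<open>f\<^sup>*\<close> of the Euclidean metric; it does
  not depend on the chart.\<close>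

definition nabla_inner ::
  "('p, 'm::finite) chart set \<Rightarrow> ('p \<Rightarrow> real^'n) \<Rightarrow>
   ('p \<Rightarrow> real^'n) \<Rightarrow> ('p \<Rightarrow> real^'n) \<Rightarrow> 'p \<Rightarrow> real" where
  "nabla_inner A f h l x =
     (let c = chart_at A x in
        \<Sum>i\<in>UNIV. \<Sum>j\<in>UNIV.
          matrix_inv (pullback_metric c f x) $ i $ j * (partial c i h x \<bullet> partial c j l x))"

text \<open>\<open>has_bochner_laplacian A f h k\<close> says \<open>\<nabla>\<^sup>*\<nabla>h = k\<close>, where \<open>\<nabla>\<^sup>*\<close> is the \<open>L\<^sup>2\<close>-adjoint of
  \<open>\<nabla>\<close>; such a \<open>k\<close> is unique.\<close>

definition has_bochner_laplacian ::
  "('p::topological_space, 'm::finite) chart set \<Rightarrow> ('p \<Rightarrow> real^'n) \<Rightarrow>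
   ('p \<Rightarrow> real^'n) \<Rightarrow> ('p \<Rightarrow> real^'n) \<Rightarrow> bool" where
  "has_bochner_laplacian A f h k \<longleftrightarrow>
     h \<in> smooth_functions A \<and> k \<in> smooth_functions A \<and>
     (\<forall>l\<in>smooth_functions A. L2_inner A f k l = (\<integral>x. nabla_inner A f h l x \<partial>vol A f))"

definition eigenspace ::
  "('p::topological_space, 'm::finite) chart set \<Rightarrow> ('p \<Rightarrow> real^'n) \<Rightarrow> real \<Rightarrow> ('p \<Rightarrow> real^'n) set" where
  "eigenspace A f \<mu> = {u. has_bochner_laplacian A f u (\<lambda>x. \<mu> *\<^sub>R u x)}"

definition spectrum ::
  "('p::topological_space, 'm::finite) chart set \<Rightarrow> ('p \<Rightarrow> real^'n) \<Rightarrow> real set" where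
  "spectrum A f = {\<mu>. \<exists>u\<in>eigenspace A f \<mu>. u \<noteq> (\<lambda>x. 0)}"

definition eigenprojection ::
  "('p::topological_space, 'm::finite) chart set \<Rightarrow> ('p \<Rightarrow> real^'n) \<Rightarrow> real \<Rightarrow>
   ('p \<Rightarrow> real^'n) \<Rightarrow> 'p \<Rightarrow> real^'n" where
  "eigenprojection A f \<mu> h =
     (THE u. u \<in> eigenspace A f \<mu> \<and>
        (\<forall>v\<in>eigenspace A f \<mu>. L2_inner A f (\<lambda>x. h x - u x) v = 0))"

text \<open>The power \<open>\<Delta>\<^sup>p\<close> for real \<open>p \<ge> 0\<close>, by the functional calculus of \<open>\<Delta>\<close>. On a compact
  manifold \<open>\<Delta>\<close> has discrete spectrum, and for smooth \<open>h\<close> the eigenfunction expansion converges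
  absolutely and uniformly together with all derivatives. The case \<open>p = 0\<close> is separate because
  \<open>0 powr 0 = 0\<close>.\<close>

definition laplacian_power ::
  "('p::topological_space, 'm::finite) chart set \<Rightarrow> ('p \<Rightarrow> real^'n) \<Rightarrow> real \<Rightarrow>
   ('p \<Rightarrow> real^'n) \<Rightarrow> 'p \<Rightarrow> real^'n" where
  "laplacian_power A f p h =
     (if p = 0 then h
      else (\<lambda>x. \<Sum>\<^sub>\<infinity>\<mu>\<in>spectrum A f. (\<mu> powr p) *\<^sub>R eigenprojection A f \<mu> h x))"

definition Hp_norm ::
  "('p::topological_space, 'm::finite) chart set \<Rightarrow> real \<Rightarrow> ('p \<Rightarrow> real^'n) \<Rightarrow>
   ('p \<Rightarrow> real^'n) \<Rightarrow> real" where
  "Hp_norm A p f h = sqrt (L2_inner A f (\<lambda>x. h x + laplacian_power A f p h x) h)"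


section \<open>Elliptic pseudo-differential operators\<close>

text \<open>Symbols of order \<open>d\<close> and type \<open>(1,0)\<close>, with values in complex matrices, as functions of
  position and covector.\<close>

definition symbol_class ::
  "real \<Rightarrow> ((real^'m::finite) \<times> (real^'m) \<Rightarrow> complex^'n::finite^'n) set" where
  "symbol_class d = {a. smooth_on UNIV a \<and>
     (\<forall>(ks::'m list) (js::'m list). \<exists>C. \<forall>y \<xi>.
        norm (foldr dir_deriv
               (map (\<lambda>i. (0, axis i 1)) ks @ map (\<lambda>j. (axis j 1, 0)) js) a (y, \<xi>))
        \<le> C * (1 + norm \<xi>) powr (d - real (length ks)))}"

definition complexify :: "real^'n \<Rightarrow> complex^'n" where
  "complexify v = (\<chi> i. complex_of_real (v $ i))"

definition fourier_transform ::
  "(real^'m::finite \<Rightarrow> real^'n::finite) \<Rightarrow> real^'m \<Rightarrow> complex^'n" where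
  "fourier_transform u \<xi> = (\<integral>y. cis (- (y \<bullet> \<xi>)) *s complexify (u y) \<partial>lborel)"

definition Op ::
  "((real^'m::finite) \<times> (real^'m) \<Rightarrow> complex^'n::finite^'n) \<Rightarrow> (real^'m \<Rightarrow> real^'n) \<Rightarrow>
   real^'m \<Rightarrow> complex^'n" where
  "Op a u y =
     (1 / (2 * pi) ^ CARD('m)) *\<^sub>R
       (\<integral>\<xi>. cis (y \<bullet> \<xi>) *s (a (y, \<xi>) *v fourier_transform u \<xi>) \<partial>lborel)"

text \<open>The operator \<open>\<phi> T \<psi>\<close> read in the coordinates of the chart \<open>c\<close>, for cutoff functions
  \<open>\<phi>\<close> and \<open>\<psi>\<close> supported in \<open>cimg c\<close>.\<close>

definition localized ::
  "('p, 'm::finite) chart \<Rightarrow> (real^'m \<Rightarrow> real) \<Rightarrow> (real^'m \<Rightarrow> real) \<Rightarrow>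
   (('p \<Rightarrow> real^'n) \<Rightarrow> 'p \<Rightarrow> real^'n) \<Rightarrow> (real^'m \<Rightarrow> real^'n) \<Rightarrow> real^'m \<Rightarrow> real^'n" where
  "localized c \<phi> \<psi> T u y =
     (if y \<in> cimg c
      then \<phi> y *\<^sub>R
        T (\<lambda>q. if q \<in> cdom c then \<psi> (coord c q) *\<^sub>R u (coord c q) else 0) (param c y)
      else 0)"

definition is_local_symbol ::
  "real \<Rightarrow> ('p, 'm::finite) chart \<Rightarrow> (real^'m \<Rightarrow> real) \<Rightarrow> (real^'m \<Rightarrow> real) \<Rightarrow>
   (('p \<Rightarrow> real^'n::finite) \<Rightarrow> 'p \<Rightarrow> real^'n) \<Rightarrow>
   ((real^'m) \<times> (real^'m) \<Rightarrow> complex^'n^'n) \<Rightarrow> bool" where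
  "is_local_symbol d c \<phi> \<psi> T a \<longleftrightarrow> a \<in> symbol_class d \<and>
     (\<forall>u. test_function UNIV u \<longrightarrow> (\<forall>y. complexify (localized c \<phi> \<psi> T u y) = Op a u y))"

definition linear_on_smooth ::
  "('p, 'm::finite) chart set \<Rightarrow> (('p \<Rightarrow> real^'n) \<Rightarrow> 'p \<Rightarrow> real^'n) \<Rightarrow> bool" where
  "linear_on_smooth A T \<longleftrightarrow>
     (\<forall>h\<in>smooth_functions A. T h \<in> smooth_functions A) \<and>
     (\<forall>h\<in>smooth_functions A. \<forall>k\<in>smooth_functions A. \<forall>r s.
        T (\<lambda>x. r *\<^sub>R h x + s *\<^sub>R k x) = (\<lambda>x. r *\<^sub>R T h x + s *\<^sub>R T k x))"

text \<open>Hoermander's definition (The Analysis of Linear Partial Differential Operators III, 18.1.20).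
  All charts of the maximal atlas are used. Their domains need not be connected, so any two points
  lie in a common chart and the off-diagonal part of the Schwartz kernel is controlled as well.\<close>

definition pseudo_differential_operator ::
  "('p::topological_space, 'm::finite) chart set \<Rightarrow> real \<Rightarrow>
   (('p \<Rightarrow> real^'n::finite) \<Rightarrow> 'p \<Rightarrow> real^'n) \<Rightarrow> bool" where
  "pseudo_differential_operator A d T \<longleftrightarrow> linear_on_smooth A T \<and>
     (\<forall>c\<in>maximal_atlas A. \<forall>\<phi> \<psi>.
        test_function (cimg c) \<phi> \<and> test_function (cimg c) \<psi> \<longrightarrow>
        (\<exists>a. is_local_symbol d c \<phi> \<psi> T a))"

text \<open>Modulo order \<open>d - 1\<close>, the symbol of \<open>\<phi> T \<psi>\<close> is \<open>\<phi>\<psi>\<close> times that of \<open>T\<close>. Ellipticity is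
  therefore tested where \<open>\<phi>\<psi>\<close> does not vanish.\<close>

definition elliptic_pseudo_differential_operator ::
  "('p::topological_space, 'm::finite) chart set \<Rightarrow> real \<Rightarrow>
   (('p \<Rightarrow> real^'n::finite) \<Rightarrow> 'p \<Rightarrow> real^'n) \<Rightarrow> bool" where
  "elliptic_pseudo_differential_operator A d T \<longleftrightarrow> pseudo_differential_operator A d T \<and>
     (\<forall>c\<in>maximal_atlas A. \<forall>\<phi> \<psi> a y0.
        test_function (cimg c) \<phi> \<and> test_function (cimg c) \<psi> \<and> is_local_symbol d c \<phi> \<psi> T a \<and>
        \<phi> y0 \<noteq> 0 \<and> \<psi> y0 \<noteq> 0 \<longrightarrow>
        (\<exists>r>0. \<exists>\<epsilon>>0. \<exists>R>0. \<forall>y\<in>ball y0 r. \<forall>\<xi>. norm \<xi> \<ge> R \<longrightarrow>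
           (\<forall>v. norm (a (y, \<xi>) *v v) \<ge> \<epsilon> * norm \<xi> powr d * norm v)))"


section \<open>Sobolev-type metrics on immersions\<close>

text \<open>Smoothness of the section \<open>P\<close> of \<open>L(TImm; TImm)\<close> is meant in the sense of convenient
  calculus: \<open>(f, h) \<mapsto> P\<^sub>f h\<close> maps smooth curves to smooth curves.\<close>

definition sobolev_type_operator ::
  "('p::topological_space, 'm::finite) chart set \<Rightarrow>
   (('p \<Rightarrow> real^'n::finite) \<Rightarrow> ('p \<Rightarrow> real^'n) \<Rightarrow> 'p \<Rightarrow> real^'n) \<Rightarrow> bool" where
  "sobolev_type_operator A P \<longleftrightarrow>
     (\<forall>F H. smooth_curve A F \<and> (\<forall>t. F t \<in> Imm A) \<and> smooth_curve A H \<longrightarrow>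
        smooth_curve A (\<lambda>t. P (F t) (H t))) \<and>
     (\<forall>f\<in>Imm A. \<exists>d. elliptic_pseudo_differential_operator A d (P f)) \<and>
     (\<forall>f\<in>Imm A. \<forall>h\<in>smooth_functions A. \<forall>k\<in>smooth_functions A.
        L2_inner A f (P f h) k = L2_inner A f h (P f k)) \<and>
     (\<forall>f\<in>Imm A. \<forall>h\<in>smooth_functions A. h \<noteq> (\<lambda>x. 0) \<longrightarrow> L2_inner A f (P f h) h > 0) \<and>
     (\<forall>f\<in>Imm A. \<forall>h\<in>smooth_functions A. \<forall>\<phi>\<in>Diff A. P f h \<circ> \<phi> = P (f \<circ> \<phi>) (h \<circ> \<phi>))"

definition GP_norm ::
  "('p::topological_space, 'm::finite) chart set \<Rightarrow>
   (('p \<Rightarrow> real^'n) \<Rightarrow> ('p \<Rightarrow> real^'n) \<Rightarrow> 'p \<Rightarrow> real^'n) \<Rightarrow>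
   ('p \<Rightarrow> real^'n) \<Rightarrow> ('p \<Rightarrow> real^'n) \<Rightarrow> real" where
  "GP_norm A P f h = sqrt (L2_inner A f (P f h) h)"


section \<open>Shape space and its distances\<close>

definition shape ::
  "('p::topological_space, 'm::finite) chart set \<Rightarrow> ('p \<Rightarrow> real^'n) \<Rightarrow> ('p \<Rightarrow> real^'n) set" where
  "shape A f = {f \<circ> \<phi> |\<phi>. \<phi> \<in> Diff A}"

definition shape_space ::
  "('p::topological_space, 'm::finite) chart set \<Rightarrow> ('p \<Rightarrow> real^'n) set set" where
  "shape_space A = shape A ` Imm A"

text \<open>The tangent space \<open>{Tf \<circ> X}\<close> at \<open>f\<close> of the \<open>Diff(M)\<close>-orbit.\<close>

definition vertical ::
  "('p, 'm::finite) chart set \<Rightarrow> ('p \<Rightarrow> real^'n) \<Rightarrow> ('p \<Rightarrow> real^'n) set" where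
  "vertical A f = {(\<lambda>x. \<chi> i. X (\<lambda>q. f q $ i) x) |X. X \<in> vector_fields A}"

text \<open>The norm of \<open>T\<^sub>f\<pi>(h)\<close> for the metric on shape space making \<open>\<pi>\<close> a Riemannian submersion:
  the quotient norm of \<open>h\<close> modulo vertical vectors, i.e. the norm of the horizontal part of \<open>h\<close>.\<close>

definition quotient_norm ::
  "('p::topological_space, 'm::finite) chart set \<Rightarrow>
   (('p \<Rightarrow> real^'n) \<Rightarrow> ('p \<Rightarrow> real^'n) \<Rightarrow> 'p \<Rightarrow> real^'n) \<Rightarrow>
   ('p \<Rightarrow> real^'n) \<Rightarrow> ('p \<Rightarrow> real^'n) \<Rightarrow> real" where
  "quotient_norm A P f h = (INF v\<in>vertical A f. GP_norm A P f (\<lambda>x. h x - v x))"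

text \<open>A path in shape space is represented by a smooth lift \<open>f\<close> to immersions; its length ks
  independent of the lift.\<close>

definition is_shape_path ::
  "('p::topological_space, 'm::finite) chart set \<Rightarrow> (real \<Rightarrow> 'p \<Rightarrow> real^'n) \<Rightarrow>
   ('p \<Rightarrow> real^'n) set \<Rightarrow> ('p \<Rightarrow> real^'n) set \<Rightarrow> bool" where
  "is_shape_path A f F0 F1 \<longleftrightarrow>
     smooth_curve A f \<and> (\<forall>t\<in>{0..1}. f t \<in> Imm A) \<and> shape A (f 0) = F0 \<and> shape A (f 1) = F1"

definition shape_path_length ::
  "('p::topological_space, 'm::finite) chart set \<Rightarrow>
   (('p \<Rightarrow> real^'n) \<Rightarrow> ('p \<Rightarrow> real^'n) \<Rightarrow> 'p \<Rightarrow> real^'n) \<Rightarrow> (real \<Rightarrow> 'p \<Rightarrow> real^'n) \<Rightarrow> real" where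
  "shape_path_length A P f =
     integral {0..1} (\<lambda>t. quotient_norm A P (f t) (\<lambda>x. vector_derivative (\<lambda>s. f s x) (at t)))"

text \<open>Infinite if there is no path, i.e. for shapes in different components.\<close>

definition shape_dist_GP ::
  "('p::topological_space, 'm::finite) chart set \<Rightarrow>
   (('p \<Rightarrow> real^'n) \<Rightarrow> ('p \<Rightarrow> real^'n) \<Rightarrow> 'p \<Rightarrow> real^'n) \<Rightarrow>
   ('p \<Rightarrow> real^'n) set \<Rightarrow> ('p \<Rightarrow> real^'n) set \<Rightarrow> ereal" where
  "shape_dist_GP A P F0 F1 =
     (INF f\<in>{f. is_shape_path A f F0 F1}. ereal (shape_path_length A P f))"

definition frechet_dist ::
  "('p::topological_space, 'm::finite) chart set \<Rightarrow>
   ('p \<Rightarrow> real^'n) set \<Rightarrow> ('p \<Rightarrow> real^'n) set \<Rightarrow> real" where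
  "frechet_dist A F0 F1 =
     Inf {(SUP x. norm (f0 x - f1 x)) |f0 f1.
            f0 \<in> Imm A \<and> f1 \<in> Imm A \<and> shape A f0 = F0 \<and> shape A f1 = F1}"

end

theory Submission
  imports Defs
begin

text \<open>Translating a small shape is cheap for a Sobolev metric but not for the Frechet distance.

  Fix an immersion \<open>f\<close> and a unit vector \<open>l\<close>, and move \<open>r f\<close> to \<open>r f + l\<close> along the straight path
  \<open>t \<mapsto> r f + t l\<close>. Its velocity is the constant field \<open>l\<close>. Constants are harmonic: for every immersion
  they are orthogonal to the eigenfunctions of \<open>\<Delta>\<close> with nonzero eigenvalue, whence \<open>\<Delta>\<^sup>p l = 0\<close> for
  \<open>p > 0\<close>. The \<open>H\<^sup>p\<close> norm of \<open>l\<close> is therefore at most the square root of twice the volume of the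
  immersion (\<open>Hp_norm_const_le\<close>). Along the path this volume is \<open>r\<close> to the power \<open>dim M\<close> times the
  volume of \<open>f\<close> (\<open>vol_scale_translate\<close>). As the \<open>G\<^sup>P\<close> norm is dominated by the \<open>H\<^sup>p\<close> norm, and the
  norm on shape space by the \<open>G\<^sup>P\<close> norm, the distance between the two shapes tends to 0 with \<open>r\<close>
  (\<open>shape_dist_translate_le\<close>). Representatives of the two shapes, on the other hand, have their images
  in balls of radius proportional to \<open>r\<close> around \<open>0\<close> and \<open>l\<close>, so the Frechet distance stays
  above \<open>1 - 2 r sup \<bar>f\<bar>\<close> (\<open>frechet_dist_translate_ge\<close>). No constant \<open>C'\<close> survives the limit.

  Most of the work goes into the volume measure. It is defined by its values in charts, and its
  existence rests on the change of variables formula for the transition maps (\<open>is_vol_vol\<close>).\<close>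

section \<open>Change of variables for nonnegative integrals\<close>

text \<open>The change of variables theorem for Lebesgue integrals speaks of coordinates indexed by a
  well-ordered type, whereas the coordinates of a manifold are indexed by an arbitrary finite type.
  A copy of that type, well-ordered by some enumeration, bridges the gap: relabelling the
  coordinates preserves both Lebesgue measure and determinants.\<close>

typedef 'a ranked = "UNIV :: 'a set" morphisms unrank rank ..

lemma bij_unrank: "bij unrank"
  by (rule o_bij[where g = rank]) (auto simp: rank_inverse unrank_inverse)

lemma bij_rank: "bij rank"
  by (rule o_bij[where g = unrank]) (auto simp: rank_inverse unrank_inverse)

lemma inv_unrank: "inv unrank = rank"
  by (rule inv_equality) (auto simp: rank_inverse unrank_inverse)

lemma inv_rank: "inv rank = unrank"
  by (rule inv_equality) (auto simp: rank_inverse unrank_inverse)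

instance ranked :: (finite) finite
proof
  have "range (rank :: 'a \<Rightarrow> 'a ranked) = UNIV"
    by (rule bij_is_surj[OF bij_rank])
  then show "finite (UNIV :: 'a ranked set)"
    using finite_imageI[OF finite[of "UNIV :: 'a set"], of rank] by simp
qed

definition enum_code :: "'a::finite \<Rightarrow> nat" where
  "enum_code = (SOME e. inj e)"

lemma inj_enum_code: "inj (enum_code :: 'a::finite \<Rightarrow> nat)"
proof -
  have "\<exists>e::'a \<Rightarrow> nat. inj e"
    using finite_imp_inj_to_nat_seg[OF finite[of "UNIV::'a set"]] by blast
  then show ?thesis unfolding enum_code_def by (rule someI_ex)
qed

instantiation ranked :: (finite) wellorder
begin

definition less_eq_ranked :: "'a ranked \<Rightarrow> 'a ranked \<Rightarrow> bool" where
  "x \<le> y \<longleftrightarrow> enum_code (unrank x) \<le> enum_code (unrank y)"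

definition less_ranked :: "'a ranked \<Rightarrow> 'a ranked \<Rightarrow> bool" where
  "x < y \<longleftrightarrow> enum_code (unrank x) < enum_code (unrank y)"

instance
proof
  fix x y :: "'a ranked"
  show "x < y \<longleftrightarrow> x \<le> y \<and> \<not> y \<le> x"
    by (auto simp: less_eq_ranked_def less_ranked_def)
  show "x \<le> x" by (simp add: less_eq_ranked_def)
  show "x \<le> y \<or> y \<le> x" by (auto simp: less_eq_ranked_def)
  show "x = y" if "x \<le> y" "y \<le> x"
    using that unfolding less_eq_ranked_def
    by (intro unrank_inject[THEN iffD1] injD[OF inj_enum_code] order.antisym)
next
  fix x y z :: "'a ranked"
  show "x \<le> z" if "x \<le> y" "y \<le> z"
    using that by (auto simp: less_eq_ranked_def)
next
  fix Q :: "'a ranked \<Rightarrow> bool" and a :: "'a ranked"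
  assume step: "\<And>x. (\<And>y. y < x \<Longrightarrow> Q y) \<Longrightarrow> Q x"
  show "Q a"
    by (induction a rule: measure_induct_rule[where f = "\<lambda>x. enum_code (unrank x)"])
      (use step in \<open>simp add: less_ranked_def\<close>)
qed

end

definition relabel :: "real^'m \<Rightarrow> real^('m ranked)" where
  "relabel y = (\<chi> j. y $ unrank j)"

definition unlabel :: "real^('m ranked) \<Rightarrow> real^'m" where
  "unlabel z = (\<chi> i. z $ rank i)"

lemma relabel_inverses [simp]: "unlabel (relabel y) = y" "relabel (unlabel z) = z"
  by (simp_all add: relabel_def unlabel_def rank_inverse unrank_inverse vec_eq_iff)

lemma linear_relabel: "linear (relabel :: real^'m::finite \<Rightarrow> _)"
  by (rule linearI) (simp_all add: relabel_def vec_eq_iff)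

lemma linear_unlabel: "linear (unlabel :: _ \<Rightarrow> real^'m::finite)"
  by (rule linearI) (simp_all add: unlabel_def vec_eq_iff)

lemma bounded_linear_relabel: "bounded_linear (relabel :: real^'m::finite \<Rightarrow> _)"
  using linear_relabel by (simp add: linear_conv_bounded_linear)

lemma bounded_linear_unlabel: "bounded_linear (unlabel :: _ \<Rightarrow> real^'m::finite)"
  using linear_unlabel by (simp add: linear_conv_bounded_linear)

lemma measurable_unlabel [measurable]: "(unlabel :: _ \<Rightarrow> real^'m::finite) \<in> borel \<rightarrow>\<^sub>M borel"
  by (intro borel_measurable_continuous_onI linear_continuous_on bounded_linear_unlabel)

lemma lborel_distr_unlabel: "distr lborel borel unlabel = (lborel :: (real^'m::finite) measure)"
proof (rule lborel_eqI[symmetric])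
  fix l u :: "real^'m" assume le: "\<And>b. b \<in> Basis \<Longrightarrow> l \<bullet> b \<le> u \<bullet> b"
  have leq: "l $ i \<le> u $ i" for i
    using le[of "axis i 1"] by (simp add: axis_in_Basis_iff inner_axis)
  have vim: "unlabel -` box l u = box (relabel l) (relabel u)"
  proof -
    have "unlabel z \<in> box l u \<longleftrightarrow> z \<in> box (relabel l) (relabel u)" for z
      unfolding mem_box_cart
    proof
      assume *: "\<forall>i. l $ i < unlabel z $ i \<and> unlabel z $ i < u $ i"
      show "\<forall>j. relabel l $ j < z $ j \<and> z $ j < relabel u $ j"
      proof
        fix j show "relabel l $ j < z $ j \<and> z $ j < relabel u $ j"
          using *[rule_format, of "unrank j"] by (simp add: relabel_def unlabel_def unrank_inverse)
      qed
    next
      assume *: "\<forall>j. relabel l $ j < z $ j \<and> z $ j < relabel u $ j"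
      show "\<forall>i. l $ i < unlabel z $ i \<and> unlabel z $ i < u $ i"
      proof
        fix i show "l $ i < unlabel z $ i \<and> unlabel z $ i < u $ i"
          using *[rule_format, of "rank i"] by (simp add: relabel_def unlabel_def rank_inverse)
      qed
    qed
    then show ?thesis by auto
  qed
  have prods: "(\<Prod>b\<in>Basis. (y :: real^'k::finite) \<bullet> b) = (\<Prod>i\<in>UNIV. y $ i)" for y
  proof -
    have "(\<Prod>b\<in>Basis. y \<bullet> b) = (\<Prod>b\<in>(\<lambda>i. axis i 1) ` UNIV. y \<bullet> b)"
      by (rule prod.cong) (auto simp: Basis_vec_def)
    also have "\<dots> = (\<Prod>i\<in>UNIV. y $ i)"
      by (subst prod.reindex) (auto simp: inj_on_def axis_eq_axis inner_axis)
    finally show ?thesis .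
  qed
  have "emeasure (distr lborel borel unlabel) (box l u) = emeasure lborel (box (relabel l) (relabel u))"
    by (subst emeasure_distr) (auto simp: vim)
  also have "\<dots> = ennreal (\<Prod>b\<in>Basis. (relabel u - relabel l) \<bullet> b)"
    by (rule emeasure_lborel_box)
       (auto simp: Basis_vec_def inner_axis relabel_def leq)
  also have "(\<Prod>b\<in>Basis. (relabel u - relabel l) \<bullet> b) = (\<Prod>j\<in>UNIV. (u - l) $ unrank j)"
    unfolding prods by (simp add: relabel_def)
  also have "\<dots> = (\<Prod>i\<in>UNIV. (u - l) $ i)"
    by (rule prod.reindex_bij_betw[OF bij_unrank, of "\<lambda>i. (u - l) $ i"])
  finally show "emeasure (distr lborel borel unlabel) (box l u) = ennreal (\<Prod>b\<in>Basis. (u - l) \<bullet> b)"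
    unfolding prods .
qed simp

text \<open>Conjugation with the bijection between the index types matches the permutations in the
  two Leibniz formulas and preserves their signs.\<close>

lemma det_relabel:
  fixes B :: "real^'m::finite^'m"
  shows "det (\<chi> i j. B $ unrank i $ unrank j) = det B"
proof -
  let ?conj = "map_permutation UNIV (unrank :: 'm ranked \<Rightarrow> 'm)"
  have conj: "?conj p i = unrank (p (rank i))" for p i
    by (simp add: map_permutation_def restrict_id_def bij_is_surj[OF bij_unrank] inv_unrank)
  have "det (\<chi> i j. B $ unrank i $ unrank j) =
      (\<Sum>p | p permutes (UNIV :: 'm ranked set).
        of_int (sign p) * (\<Prod>i\<in>UNIV. B $ unrank i $ unrank (p i)))"
    by (simp add: det_def)
  also have "\<dots> = (\<Sum>p | p permutes (UNIV :: 'm ranked set).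
        of_int (sign (?conj p)) * (\<Prod>i\<in>UNIV. B $ i $ ?conj p i))"
  proof (rule sum.cong[OF refl], clarify)
    fix p :: "'m ranked \<Rightarrow> 'm ranked" assume p: "p permutes UNIV"
    have "(\<Prod>i\<in>UNIV. B $ unrank i $ unrank (p i)) = (\<Prod>i\<in>UNIV. B $ unrank i $ ?conj p (unrank i))"
      by (simp add: conj unrank_inverse)
    also have "\<dots> = (\<Prod>i\<in>UNIV. B $ i $ ?conj p i)"
      by (rule prod.reindex_bij_betw[OF bij_unrank, of "\<lambda>i. B $ i $ ?conj p i"])
    finally show "of_int (sign p) * (\<Prod>i\<in>UNIV. B $ unrank i $ unrank (p i)) =
        of_int (sign (?conj p)) * (\<Prod>i\<in>UNIV. B $ i $ ?conj p i)"
      using p by (simp add: sign_map_permutation bij_is_inj[OF bij_unrank])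
  qed
  also have "\<dots> = (\<Sum>q | q permutes (UNIV :: 'm set). of_int (sign q) * (\<Prod>i\<in>UNIV. B $ i $ q i))"
  proof (rule sum.reindex_bij_betw[where h = ?conj])
    show "bij_betw ?conj {p. p permutes UNIV} {q. q permutes UNIV}"
    proof (rule bij_betw_byWitness[where f' = "map_permutation UNIV (rank :: 'm \<Rightarrow> 'm ranked)"])
      have conj': "map_permutation UNIV (rank :: 'm \<Rightarrow> 'm ranked) q j = rank (q (unrank j))" for q j
        by (simp add: map_permutation_def restrict_id_def bij_is_surj[OF bij_rank] inv_rank)
      show "\<forall>p\<in>{p. p permutes UNIV}. map_permutation UNIV rank (?conj p) = p"
        by (simp add: fun_eq_iff conj conj' unrank_inverse)
      show "\<forall>q\<in>{q. q permutes UNIV}. ?conj (map_permutation UNIV rank q) = q"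
        by (simp add: fun_eq_iff conj conj' rank_inverse)
      show "?conj ` {p. p permutes UNIV} \<subseteq> {q. q permutes UNIV}"
        using map_permutation_permutes bij_unrank by blast
      show "map_permutation UNIV (rank :: 'm \<Rightarrow> 'm ranked) ` {q. q permutes UNIV} \<subseteq> {p. p permutes UNIV}"
        using map_permutation_permutes bij_rank by blast
    qed
  qed
  finally show ?thesis by (simp add: det_def)
qed

text \<open>The theorem for integrable functions is an equivalence between finite values of the two
  integrals. Applied to every real value \<open>b\<close> it makes the two nonnegative integrals agree whenever
  one of them is finite, hence always.\<close>

lemma nn_integral_change_of_variables_wellorder:
  fixes g :: "real^'w::{finite,wellorder} \<Rightarrow> real^'w::_" and \<delta> :: "real^'w::_ \<Rightarrow> real"
  assumes S: "S \<in> sets borel" and gS: "g ` S \<in> sets borel"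
    and der: "\<And>x. x \<in> S \<Longrightarrow> (g has_derivative g' x) (at x)"
    and inj: "inj_on g S"
    and m1: "(\<lambda>y. indicator (g ` S) y * \<delta> y) \<in> borel_measurable borel"
    and m2: "(\<lambda>x. indicator S x * (\<bar>det (matrix (g' x))\<bar> * \<delta> (g x))) \<in> borel_measurable borel"
  shows "(\<integral>\<^sup>+y. ennreal (\<delta> y) * indicator (g ` S) y \<partial>lborel) =
         (\<integral>\<^sup>+x. ennreal (\<bar>det (matrix (g' x))\<bar> * \<delta> (g x)) * indicator S x \<partial>lborel)"
proof -
  (* The formula for integrable functions determines the integral of a nonnegative function, so
     the negative part of \<delta>, invisible to the integrals at hand, is cut off first. *)
  define \<delta>' where "\<delta>' y = max 0 (\<delta> y)" for y
  let ?d = "\<lambda>x. \<bar>det (matrix (g' x))\<bar> * \<delta>' (g x)"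
  let ?L = "\<integral>\<^sup>+y. ennreal (indicator (g ` S) y * \<delta>' y) \<partial>lborel"
  let ?R = "\<integral>\<^sup>+x. ennreal (indicator S x * ?d x) \<partial>lborel"
  have pos: "ennreal (max 0 a) = ennreal a" for a :: real
    by (simp add: max_def ennreal_neg)
  have max_mult: "b * max 0 a = max 0 (b * a)" if "0 \<le> b" for a b :: real
    using that by (auto simp: max_def mult_le_0_iff zero_le_mult_iff)
  have L: "(\<integral>\<^sup>+y. ennreal (\<delta> y) * indicator (g ` S) y \<partial>lborel) = ?L"
    and R: "(\<integral>\<^sup>+x. ennreal (\<bar>det (matrix (g' x))\<bar> * \<delta> (g x)) * indicator S x \<partial>lborel) = ?R"
    by (auto intro!: nn_integral_cong simp: \<delta>'_def pos max_mult split: split_indicator)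
  have m1': "(\<lambda>y. indicator (g ` S) y * \<delta>' y) \<in> borel_measurable borel"
    using borel_measurable_max[OF m1 borel_measurable_const[of 0]] by (simp add: \<delta>'_def pos max_mult)
  have m2': "(\<lambda>x. indicator S x * ?d x) \<in> borel_measurable borel"
    using borel_measurable_max[OF m2 borel_measurable_const[of 0]] by (simp add: \<delta>'_def pos max_mult)
  have key: "set_integrable lebesgue S ?d \<and> integral S ?d = b \<longleftrightarrow>
      set_integrable lebesgue (g ` S) \<delta>' \<and> integral (g ` S) \<delta>' = b" for b :: real
  proof -
    have "((\<lambda>x. \<bar>det (matrix (g' x))\<bar> *\<^sub>R (vec (\<delta>' (g x)) :: real^1)) absolutely_integrable_on S \<and>
           integral S (\<lambda>x. \<bar>det (matrix (g' x))\<bar> *\<^sub>R (vec (\<delta>' (g x)) :: real^1)) = vec b)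
        \<longleftrightarrow> ((\<lambda>y. vec (\<delta>' y) :: real^1) absolutely_integrable_on (g ` S) \<and>
           integral (g ` S) (\<lambda>y. vec (\<delta>' y) :: real^1) = vec b)"
    proof (rule has_absolute_integral_change_of_variables)
      show "S \<in> sets lebesgue" using S by simp
      show "(g has_derivative g' x) (at x within S)" if "x \<in> S" for x
        using der[OF that] by (rule has_derivative_at_withinI)
    qed (rule inj)
    moreover have "integral S (\<lambda>x. \<bar>det (matrix (g' x))\<bar> *\<^sub>R (vec (\<delta>' (g x)) :: real^1)) = vec (integral S ?d)"
      by (subst integral_on_1_eq) simp
    moreover have "integral (g ` S) (\<lambda>y. vec (\<delta>' y) :: real^1) = vec (integral (g ` S) \<delta>')"
      by (subst integral_on_1_eq) simp
    moreover have "(\<lambda>x. \<bar>det (matrix (g' x))\<bar> *\<^sub>R (vec (\<delta>' (g x)) :: real^1)) absolutely_integrable_on S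
        \<longleftrightarrow> ?d absolutely_integrable_on S"
      by (subst absolutely_integrable_on_1_iff) simp
    moreover have "(\<lambda>y. vec (\<delta>' y) :: real^1) absolutely_integrable_on (g ` S)
        \<longleftrightarrow> \<delta>' absolutely_integrable_on (g ` S)"
      by (subst absolutely_integrable_on_1_iff) simp
    ultimately show ?thesis by (simp only: vec_eq)
  qed
  have conv: "set_integrable lebesgue Q \<eta> \<and> integral Q \<eta> = b \<longleftrightarrow>
      (\<integral>\<^sup>+y. ennreal (indicator Q y * \<eta> y) \<partial>lborel) = ennreal b"
    if m: "(\<lambda>y. indicator Q y * \<eta> y) \<in> borel_measurable borel" and nn: "\<And>y. y \<in> Q \<Longrightarrow> 0 \<le> \<eta> y"
      and b: "0 \<le> b" for Q and \<eta> :: "real^'w::_ \<Rightarrow> real" and b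
  proof -
    have "(\<integral>\<^sup>+y. ennreal (indicator Q y * \<eta> y) \<partial>lborel) = ennreal b \<longleftrightarrow>
        integrable lborel (\<lambda>y. indicator Q y * \<eta> y) \<and> integral\<^sup>L lborel (\<lambda>y. indicator Q y * \<eta> y) = b"
      using m b by (intro nn_integral_eq_integrable) (auto simp: nn split: split_indicator)
    also have "\<dots> \<longleftrightarrow> integrable lebesgue (\<lambda>y. indicator Q y * \<eta> y) \<and>
        integral\<^sup>L lebesgue (\<lambda>y. indicator Q y * \<eta> y) = b"
    proof -
      have "(\<lambda>y. indicator Q y * \<eta> y) \<in> lborel \<rightarrow>\<^sub>M borel" using m by simp
      from integrable_completion[OF this] integral_completion[OF this] show ?thesis by simp
    qed
    also have "\<dots> \<longleftrightarrow> set_integrable lebesgue Q \<eta> \<and> integral Q \<eta> = b"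
      using set_lebesgue_integral_eq_integral(2)[of Q \<eta>]
      unfolding set_integrable_def set_lebesgue_integral_def real_scaleR_def by metis
    finally show ?thesis by blast
  qed
  have nnL: "0 \<le> \<delta>' y" for y by (simp add: \<delta>'_def)
  have nnS: "0 \<le> ?d x" if "x \<in> S" for x using nnL by simp
  have eq: "?L = ennreal b \<longleftrightarrow> ?R = ennreal b" if "0 \<le> b" for b
    using conv[OF m1' nnL that] conv[OF m2' nnS that] key[of b] by blast
  have "?L = ?R"
  proof (cases ?L)
    case (real b) then show ?thesis using eq[of b] by simp
  next
    case top
    show ?thesis
    proof (cases ?R)
      case (real b) then show ?thesis using eq[of b] by simp
    qed (use top in simp)
  qed
  with L R show ?thesis by simp
qed

text \<open>The well-ordered case, conjugated with the relabelling of the coordinates.\<close>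

lemma nn_integral_change_of_variables:
  fixes g :: "real^'m::finite \<Rightarrow> real^'m" and \<delta> :: "real^'m \<Rightarrow> real"
  assumes S: "S \<in> sets borel" and gS: "g ` S \<in> sets borel"
    and der: "\<And>x. x \<in> S \<Longrightarrow> (g has_derivative g' x) (at x)"
    and inj: "inj_on g S"
    and m1: "(\<lambda>y. indicator (g ` S) y * \<delta> y) \<in> borel_measurable borel"
    and m2: "(\<lambda>x. indicator S x * (\<bar>det (matrix (g' x))\<bar> * \<delta> (g x))) \<in> borel_measurable borel"
  shows "(\<integral>\<^sup>+y. ennreal (\<delta> y) * indicator (g ` S) y \<partial>lborel) =
         (\<integral>\<^sup>+x. ennreal (\<bar>det (matrix (g' x))\<bar> * \<delta> (g x)) * indicator S x \<partial>lborel)"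
proof -
  let ?G = "\<lambda>z. relabel (g (unlabel z))"
  let ?G' = "\<lambda>z v. relabel (g' (unlabel z) (unlabel v))"
  let ?S = "relabel ` S"
  let ?d = "\<lambda>x. \<bar>det (matrix (g' x))\<bar> * \<delta> (g x)"
  have vim: "relabel ` Q = unlabel -` Q" for Q :: "(real^'m) set"
    using image_eqI[where f = relabel and x = "unlabel _" and A = Q] by force
  have GS: "?G ` ?S = relabel ` (g ` S)"
    by (simp add: image_image)
  have ind: "indicator (relabel ` Q) z = indicator Q (unlabel z)" for Q :: "(real^'m) set" and z
    unfolding vim by (simp add: indicator_def)
  have bor: "relabel ` Q \<in> sets borel" if "Q \<in> sets borel" for Q :: "(real^'m) set"
    unfolding vim using measurable_sets[OF measurable_unlabel that] by simp
  have pull: "(\<integral>\<^sup>+y. \<phi> y \<partial>lborel) = (\<integral>\<^sup>+z. \<phi> (unlabel z) \<partial>lborel)"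
    if "\<phi> \<in> borel_measurable borel" for \<phi> :: "real^'m \<Rightarrow> ennreal"
    by (subst lborel_distr_unlabel[symmetric], subst nn_integral_distr) (use that in simp_all)
  have det_eq: "det (matrix (?G' z)) = det (matrix (g' (unlabel z)))" for z
  proof -
    have "unlabel (axis j 1) = (axis (unrank j) 1 :: real^'m)" for j
      by (simp add: unlabel_def axis_def vec_eq_iff) (metis rank_inverse unrank_inverse UNIV_I)
    then have "matrix (?G' z) = (\<chi> i j. matrix (g' (unlabel z)) $ unrank i $ unrank j)"
      by (simp add: matrix_def relabel_def)
    then show ?thesis by (simp only: det_relabel)
  qed
  have e1: "ennreal (\<delta> y) * indicator (g ` S) y = ennreal (indicator (g ` S) y * \<delta> y)" for y
    by (simp split: split_indicator)
  have e2: "ennreal (?d x) * indicator S x = ennreal (indicator S x * ?d x)" for x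
    by (simp split: split_indicator)
  have "(\<integral>\<^sup>+y. ennreal (\<delta> y) * indicator (g ` S) y \<partial>lborel) =
      (\<integral>\<^sup>+z. ennreal (\<delta> (unlabel z)) * indicator (?G ` ?S) z \<partial>lborel)"
    unfolding GS ind using m1 by (subst pull) (simp_all add: e1)
  also have "\<dots> = (\<integral>\<^sup>+z. ennreal (\<bar>det (matrix (?G' z))\<bar> * \<delta> (unlabel (?G z))) * indicator ?S z \<partial>lborel)"
  proof (rule nn_integral_change_of_variables_wellorder)
    show "?S \<in> sets borel" "?G ` ?S \<in> sets borel"
      unfolding GS using bor S gS by auto
    show "(?G has_derivative ?G' z) (at z)" if "z \<in> ?S" for z
    proof -
      have "(g has_derivative g' (unlabel z)) (at (unlabel z))"
        using that der by auto
      then have "((\<lambda>z. g (unlabel z)) has_derivative (\<lambda>v. g' (unlabel z) (unlabel v))) (at z)"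
        by (rule has_derivative_compose[OF bounded_linear_imp_has_derivative[OF bounded_linear_unlabel]])
      then show ?thesis
        by (rule bounded_linear.has_derivative[OF bounded_linear_relabel])
    qed
    show "inj_on ?G ?S"
    proof (rule inj_onI)
      fix a b assume "a \<in> ?S" "b \<in> ?S" and eq: "?G a = ?G b"
      then obtain x y where x: "x \<in> S" "a = relabel x" and y: "y \<in> S" "b = relabel y" by blast
      have "unlabel (?G a) = unlabel (?G b)" using eq by simp
      then show "a = b" using x y inj by (simp add: inj_on_eq_iff)
    qed
    show "(\<lambda>z. indicator (?G ` ?S) z * \<delta> (unlabel z)) \<in> borel_measurable borel"
      unfolding GS ind using measurable_compose[OF measurable_unlabel m1] .
    show "(\<lambda>z. indicator ?S z * (\<bar>det (matrix (?G' z))\<bar> * \<delta> (unlabel (?G z)))) \<in> borel_measurable borel"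
      unfolding ind det_eq relabel_inverses using measurable_compose[OF measurable_unlabel m2] .
  qed
  also have "\<dots> = (\<integral>\<^sup>+x. ennreal (?d x) * indicator S x \<partial>lborel)"
    unfolding ind det_eq relabel_inverses using m2 by (subst pull) (simp_all add: e2)
  finally show ?thesis .
qed

section \<open>Calculus of smooth maps\<close>

lemma frechet_derivative_cong_open:
  assumes "open S" "x \<in> S" "\<And>y. y \<in> S \<Longrightarrow> f y = g y"
  shows "frechet_derivative f (at x) = frechet_derivative g (at x)"
proof -
  have "(f has_derivative f') (at x) \<longleftrightarrow> (g has_derivative f') (at x)" for f'
    using assms by (metis has_derivative_transform_within_open)
  then show ?thesis unfolding frechet_derivative_def by simp
qed

lemma frechet_derivative_eqI:
  "(f has_derivative f') (at x) \<Longrightarrow> frechet_derivative f (at x) v = f' v"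
  using frechet_derivative_at[of f f' x] by simp

lemma Ck_on_cong:
  assumes "open S" and "\<And>x. x \<in> S \<Longrightarrow> f x = g x"
  shows "Ck_on k S f \<longleftrightarrow> Ck_on k S g"
proof -
  have imp: "Ck_on k S f \<Longrightarrow> (\<And>x. x \<in> S \<Longrightarrow> f x = g x) \<Longrightarrow> Ck_on k S g" for f g
  proof (induction k arbitrary: f g)
    case 0 then show ?case using continuous_on_cong[of S S f g] by simp
  next
    case (Suc k)
    have "g differentiable_on S"
      using Suc.prems unfolding Ck_on.simps differentiable_on_def
      by (metis differentiable_transform_within zero_less_one)
    moreover have "Ck_on k S (\<lambda>x. frechet_derivative g (at x) v)" for v
      by (rule Suc.IH[of "\<lambda>x. frechet_derivative f (at x) v"])
         (use Suc.prems frechet_derivative_cong_open[OF \<open>open S\<close>, of _ f g] in auto)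
    ultimately show ?case by simp
  qed
  from imp[of f g] imp[of g f] assms(2) show ?thesis by auto
qed

lemma Ck_on_Suc_has_derivative:
  assumes "Ck_on (Suc k) S f" "open S" "x \<in> S"
  shows "(f has_derivative frechet_derivative f (at x)) (at x)"
  using assms by (auto simp: differentiable_on_eq_differentiable_at frechet_derivative_works)

lemma Ck_on_SucI:
  assumes "open S" and "\<And>x. x \<in> S \<Longrightarrow> (f has_derivative f' x) (at x)"
    and "\<And>v. Ck_on k S (\<lambda>x. f' x v)"
  shows "Ck_on (Suc k) S f"
proof -
  have "f differentiable_on S"
    using assms(1,2) by (auto simp: differentiable_on_eq_differentiable_at differentiable_def)
  moreover have "Ck_on k S (\<lambda>x. frechet_derivative f (at x) v)" for v
    using assms(3)[of v] Ck_on_cong[OF assms(1), of "\<lambda>x. frechet_derivative f (at x) v" "\<lambda>x. f' x v" k]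
      frechet_derivative_eqI[OF assms(2)] by auto
  ultimately show ?thesis by simp
qed

lemma Ck_on_const: "open S \<Longrightarrow> Ck_on k S (\<lambda>x. c)"
proof (induction k arbitrary: c)
  case (Suc k)
  then show ?case by (intro Ck_on_SucI[where f' = "\<lambda>x v. 0"]) auto
qed simp

lemma Ck_on_linear:
  assumes "bounded_linear B" "open S" shows "Ck_on k S B"
proof (cases k)
  case 0 then show ?thesis using assms by (simp add: linear_continuous_on)
next
  case (Suc k)
  show ?thesis unfolding Suc
    by (rule Ck_on_SucI[where f' = "\<lambda>x. B"])
       (use assms in \<open>auto intro: Ck_on_const bounded_linear_imp_has_derivative\<close>)
qed

text \<open>Affine substitutions suffice here: they cover the projection \<open>\<real> \<times> M \<rightarrow> M\<close> and the inclusions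
  of the slices \<open>{t} \<times> M\<close>, and the chain rule then produces no products, so that induction on the
  order of differentiability goes through directly.\<close>

lemma Ck_on_compose_affine:
  assumes L: "bounded_linear L" and "open S" "open T" and sub: "\<And>x. x \<in> T \<Longrightarrow> a + L x \<in> S"
  shows "Ck_on k S f \<Longrightarrow> Ck_on k T (\<lambda>x. f (a + L x))"
proof (induction k arbitrary: f)
  case 0
  have "continuous_on T (\<lambda>x. a + L x)"
    using L by (intro continuous_intros linear_continuous_on)
  then show ?case using 0 continuous_on_compose2[of S f T "\<lambda>x. a + L x"] sub by auto
next
  case (Suc k)
  show ?case
  proof (rule Ck_on_SucI[OF \<open>open T\<close>])
    fix x assume "x \<in> T"
    have "((\<lambda>x. a + L x) has_derivative L) (at x)"
      using has_derivative_add[OF has_derivative_const bounded_linear_imp_has_derivative[OF L]] by simp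
    from has_derivative_compose[OF this Ck_on_Suc_has_derivative[OF Suc.prems \<open>open S\<close> sub[OF \<open>x \<in> T\<close>]]]
    show "((\<lambda>x. f (a + L x)) has_derivative (\<lambda>v. frechet_derivative f (at (a + L x)) (L v))) (at x)" .
  next
    show "Ck_on k T (\<lambda>x. frechet_derivative f (at (a + L x)) (L v))" for v
      using Suc.prems by (intro Suc.IH[of "\<lambda>z. frechet_derivative f (at z) (L v)"]) simp
  qed
qed

lemma Ck_on_linear_compose:
  assumes B: "bounded_linear B" and "open S"
  shows "Ck_on k S f \<Longrightarrow> Ck_on k S (\<lambda>x. B (f x))"
proof (induction k arbitrary: f)
  case 0 then show ?case using bounded_linear.continuous_on[OF B] by simp
next
  case (Suc k)
  show ?case
    using Suc.prems bounded_linear.has_derivative[OF B Ck_on_Suc_has_derivative[OF Suc.prems \<open>open S\<close>]]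
    by (intro Ck_on_SucI[OF \<open>open S\<close>, where f' = "\<lambda>x v. B (frechet_derivative f (at x) v)"] Suc.IH)
       simp_all
qed

lemma Ck_on_add:
  assumes "open S"
  shows "Ck_on k S f \<Longrightarrow> Ck_on k S g \<Longrightarrow> Ck_on k S (\<lambda>x. f x + g x)"
proof (induction k arbitrary: f g)
  case 0 then show ?case by (simp add: continuous_on_add)
next
  case (Suc k)
  show ?case
    using Suc.prems has_derivative_add[OF Ck_on_Suc_has_derivative[OF Suc.prems(1) assms]
        Ck_on_Suc_has_derivative[OF Suc.prems(2) assms]]
    by (intro Suc.IH Ck_on_SucI[OF assms,
          where f' = "\<lambda>x v. frechet_derivative f (at x) v + frechet_derivative g (at x) v"]) simp_all
qed

lemma smooth_on_differentiable:
  "smooth_on S f \<Longrightarrow> open S \<Longrightarrow> x \<in> S \<Longrightarrow> (f has_derivative frechet_derivative f (at x)) (at x)"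
  unfolding smooth_on_def using Ck_on_Suc_has_derivative by blast

lemma smooth_on_continuous_derivative:
  "smooth_on S f \<Longrightarrow> continuous_on S (\<lambda>x. frechet_derivative f (at x) v)"
  unfolding smooth_on_def by (drule spec[of _ "Suc 0"]) simp

lemma smooth_on_continuous: "smooth_on S f \<Longrightarrow> continuous_on S f"
  unfolding smooth_on_def by (drule spec[of _ 0]) simp

section \<open>Smooth functions on a manifold\<close>

lemma smooth_atlasD:
  assumes "smooth_atlas A" "c \<in> A"
  shows "open (cdom c)" "open (cimg c)" "homeomorphism (cdom c) (cimg c) (coord c) (param c)"
  using assms by (auto simp: smooth_atlas_def is_chart_def)

lemma smooth_atlas_covers:
  assumes "smooth_atlas A" obtains c where "c \<in> A" "x \<in> cdom c"
  using assms unfolding smooth_atlas_def by blast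

lemma chart_simps:
  assumes "smooth_atlas A" "c \<in> A"
  shows "x \<in> cdom c \<Longrightarrow> param c (coord c x) = x" "y \<in> cimg c \<Longrightarrow> coord c (param c y) = y"
    "x \<in> cdom c \<Longrightarrow> coord c x \<in> cimg c" "y \<in> cimg c \<Longrightarrow> param c y \<in> cdom c"
  using smooth_atlasD(3)[OF assms] by (auto simp: homeomorphism_def)

lemma smooth_functionsI:
  assumes "smooth_atlas A"
    and "\<And>c k. c \<in> A \<Longrightarrow> open (cimg c) \<Longrightarrow> Ck_on k (cimg c) (\<lambda>y. f (param c y))"
  shows "f \<in> smooth_functions A"
  using assms(2) smooth_atlasD(2)[OF assms(1)]
  by (simp add: smooth_functions_def smooth_on_def o_def)

lemma smooth_functionsD:
  "f \<in> smooth_functions A \<Longrightarrow> c \<in> A \<Longrightarrow> Ck_on k (cimg c) (\<lambda>y. f (param c y))"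
  by (simp add: smooth_functions_def smooth_on_def o_def)

lemma smooth_functions_const:
  assumes "smooth_atlas A" shows "(\<lambda>x. c) \<in> smooth_functions A"
  by (rule smooth_functionsI[OF assms]) (rule Ck_on_const)

lemma smooth_functions_add:
  assumes "smooth_atlas A" "f \<in> smooth_functions A" "g \<in> smooth_functions A"
  shows "(\<lambda>x. f x + g x) \<in> smooth_functions A"
  using assms(2,3)[THEN smooth_functionsD] by (intro smooth_functionsI[OF assms(1)] Ck_on_add)

lemma smooth_functions_linear:
  assumes "smooth_atlas A" "bounded_linear B" "f \<in> smooth_functions A"
  shows "(\<lambda>x. B (f x)) \<in> smooth_functions A"
  using assms(3)[THEN smooth_functionsD]
  by (intro smooth_functionsI[OF assms(1)] Ck_on_linear_compose[OF assms(2)])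

lemma smooth_functions_diff:
  assumes "smooth_atlas A" "f \<in> smooth_functions A" "g \<in> smooth_functions A"
  shows "(\<lambda>x. f x - g x) \<in> smooth_functions A"
  using smooth_functions_add[OF assms(1,2) smooth_functions_linear[OF assms(1) _ assms(3), of uminus]]
  by (simp add: bounded_linear_minus bounded_linear_ident)

lemma smooth_functions_scale_translate:
  assumes "smooth_atlas A" "f \<in> smooth_functions A"
  shows "(\<lambda>x. r *\<^sub>R f x + b) \<in> smooth_functions A"
  by (rule smooth_functions_add[OF assms(1)
        smooth_functions_linear[OF assms(1) bounded_linear_scaleR_right assms(2)]
        smooth_functions_const[OF assms(1)]])

lemma smooth_functions_sum:
  assumes "smooth_atlas A" "\<And>i. i \<in> I \<Longrightarrow> f i \<in> smooth_functions A"
  shows "(\<lambda>x. \<Sum>i\<in>I. f i x) \<in> smooth_functions A"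
  using assms(2)
  by (induction I rule: infinite_finite_induct)
     (auto intro: smooth_functions_add[OF assms(1)] smooth_functions_const[OF assms(1)])

lemma smooth_functions_vec:
  fixes f :: "'i::finite \<Rightarrow> 'p::topological_space \<Rightarrow> real"
  assumes "smooth_atlas A" "\<And>i. f i \<in> smooth_functions A"
  shows "(\<lambda>x. \<chi> i. f i x) \<in> smooth_functions A"
proof -
  have "(\<lambda>x. \<Sum>i\<in>UNIV. f i x *\<^sub>R (axis i 1 :: real^'i)) \<in> smooth_functions A"
    by (rule smooth_functions_sum[OF assms(1)])
       (rule smooth_functions_linear[OF assms(1) bounded_linear_scaleR_left assms(2)])
  moreover have "(\<Sum>i\<in>UNIV. f i x *\<^sub>R (axis i 1 :: real^'i)) = (\<chi> i. f i x)" for x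
    by (simp add: vec_eq_iff axis_def if_distrib cong: if_cong)
  ultimately show ?thesis by simp
qed

lemma smooth_functions_continuous:
  assumes A: "smooth_atlas A" and f: "f \<in> smooth_functions A"
  shows "continuous_on UNIV f"
proof -
  have "continuous_on (\<Union>c\<in>A. cdom c) f"
  proof (rule continuous_on_open_UN)
    fix c assume c: "c \<in> A"
    show "open (cdom c)" using smooth_atlasD[OF A c] by simp
    have "continuous_on (cimg c) (f \<circ> param c)"
      using f c by (intro smooth_on_continuous) (simp add: smooth_functions_def)
    moreover have "continuous_on (cdom c) (coord c)" "coord c ` cdom c = cimg c"
      using smooth_atlasD(3)[OF A c] by (auto simp: homeomorphism_def)
    ultimately have "continuous_on (cdom c) ((f \<circ> param c) \<circ> coord c)"
      by (metis continuous_on_compose)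
    then show "continuous_on (cdom c) f"
      by (rule continuous_on_eq) (simp add: chart_simps[OF A c])
  qed
  then show ?thesis using A by (simp add: smooth_atlas_def)
qed

text \<open>The velocity is the directional derivative along \<open>(1, 0)\<close> of the joint map, restricted to a
  slice \<open>{t} \<times> M\<close>.\<close>

lemma smooth_curve_velocity:
  assumes A: "smooth_atlas A" and F: "smooth_curve A F"
  shows "(\<lambda>x. vector_derivative (\<lambda>s. F s x) (at t)) \<in> smooth_functions A"
  unfolding smooth_functions_def
proof (intro CollectI ballI)
  fix c assume c: "c \<in> A"
  note o = smooth_atlasD(2)[OF A c]
  let ?G = "\<lambda>(t, y). F t (param c y)"
  have oU: "open ((UNIV :: real set) \<times> cimg c)" using o by (simp add: open_Times)
  have G: "smooth_on (UNIV \<times> cimg c) ?G" using F c by (simp add: smooth_curve_def)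
  have "Ck_on k (UNIV \<times> cimg c) (\<lambda>z. frechet_derivative ?G (at z) (1, 0))" for k
    using G unfolding smooth_on_def by (elim allE[of _ "Suc k"]) simp
  then have Ck: "Ck_on k (cimg c) (\<lambda>y. frechet_derivative ?G (at ((t, 0) + (0, y))) (1, 0))" for k
    by (intro Ck_on_compose_affine[of "\<lambda>y. (0, y)" "UNIV \<times> cimg c" "cimg c" "(t, 0)"
          k "\<lambda>z. frechet_derivative ?G (at z) (1, 0)"])
       (auto intro!: bounded_linear_Pair bounded_linear_zero bounded_linear_ident oU o)
  have eq: "frechet_derivative ?G (at ((t, 0) + (0, y))) (1, 0) =
      vector_derivative (\<lambda>s. F s (param c y)) (at t)" if y: "y \<in> cimg c" for y
  proof -
    have dG: "(?G has_derivative frechet_derivative ?G (at (t, y))) (at (t, y))"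
      using smooth_on_differentiable[OF G oU, of "(t, y)"] y by simp
    have "((\<lambda>s. (s, y)) has_derivative (\<lambda>v. (v, 0))) (at t)"
      by (intro has_derivative_Pair has_derivative_ident has_derivative_const)
    from has_derivative_compose[OF this dG]
    have d: "((\<lambda>s. F s (param c y)) has_derivative (\<lambda>v. frechet_derivative ?G (at (t, y)) (v, 0))) (at t)"
      by simp
    have "frechet_derivative ?G (at (t, y)) (v, 0) = v *\<^sub>R frechet_derivative ?G (at (t, y)) (1, 0)" for v
      using linear_cmul[OF has_derivative_linear[OF dG], of v "(1, 0)"] by simp
    then have lin: "(\<lambda>v. frechet_derivative ?G (at (t, y)) (v, 0)) =
        (\<lambda>v. v *\<^sub>R frechet_derivative ?G (at (t, y)) (1, 0))"
      by (rule ext)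
    have "((\<lambda>s. F s (param c y)) has_vector_derivative
        frechet_derivative ?G (at (t, y)) (1, 0)) (at t)"
      using d unfolding has_vector_derivative_def lin .
    then show ?thesis by (simp add: vector_derivative_at)
  qed
  show "smooth_on (cimg c) ((\<lambda>x. vector_derivative (\<lambda>s. F s x) (at t)) \<circ> param c)"
    unfolding smooth_on_def
  proof
    fix k
    show "Ck_on k (cimg c) ((\<lambda>x. vector_derivative (\<lambda>s. F s x) (at t)) \<circ> param c)"
      using Ck[of k] Ck_on_cong[OF o, of "\<lambda>y. frechet_derivative ?G (at ((t, 0) + (0, y))) (1, 0)"
        "(\<lambda>x. vector_derivative (\<lambda>s. F s x) (at t)) \<circ> param c" k] eq by simp
  qed
qed

lemma smooth_curve_translation:
  fixes f :: "'p::topological_space \<Rightarrow> real^'n::finite"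
  assumes A: "smooth_atlas A" and f: "f \<in> smooth_functions A"
  shows "smooth_curve A (\<lambda>t x. f x + t *\<^sub>R l)"
  unfolding smooth_curve_def smooth_on_def
proof (intro ballI allI)
  fix c k assume c: "c \<in> A"
  note o = smooth_atlasD(2)[OF A c]
  have oU: "open ((UNIV :: real set) \<times> cimg c)" using o by (simp add: open_Times)
  have fk: "Ck_on k (cimg c) (f \<circ> param c)"
    using f c by (auto simp: smooth_functions_def smooth_on_def)
  have "Ck_on k (UNIV \<times> cimg c) (\<lambda>z :: real \<times> _. (f \<circ> param c) (0 + snd z))"
    by (rule Ck_on_compose_affine[OF bounded_linear_snd o oU _ fk]) auto
  then have "Ck_on k (UNIV \<times> cimg c) (\<lambda>z. (f \<circ> param c) (0 + snd z) + fst z *\<^sub>R l)"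
    by (rule Ck_on_add[OF oU])
       (rule Ck_on_linear[OF bounded_linear_compose[OF bounded_linear_scaleR_left bounded_linear_fst] oU])
  then show "Ck_on k (UNIV \<times> cimg c) (\<lambda>(t, y). f (param c y) + t *\<^sub>R l)"
    by (simp add: case_prod_unfold)
qed

section \<open>The Riemannian volume of an immersion\<close>

text \<open>In coordinates, \<open>gram (Df)\<close> is the matrix of the metric pulled back by \<open>f\<close>.\<close>

definition gram :: "(real^'m::finite \<Rightarrow> real^'n) \<Rightarrow> real^'m^'m" where
  "gram L = (\<chi> i j. L (axis i 1) \<bullet> L (axis j 1))"

definition vol_density :: "('p, 'm::finite) chart \<Rightarrow> ('p \<Rightarrow> real^'n) \<Rightarrow> real^'m \<Rightarrow> real" where
  "vol_density c f y = sqrt (det (pullback_metric c f (param c y)))"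

text \<open>The value that \<open>is_vol\<close> prescribes for sets inside a chart domain.\<close>

definition local_volume ::
  "('p, 'm::finite) chart \<Rightarrow> ('p \<Rightarrow> real^'n) \<Rightarrow> 'p set \<Rightarrow> ennreal" where
  "local_volume c f B = (\<integral>\<^sup>+y. ennreal (vol_density c f y) * indicator (coord c ` B) y \<partial>lborel)"

lemma is_vol_iff:
  "is_vol A f \<mu> \<longleftrightarrow> sets \<mu> = sets borel \<and>
     (\<forall>c\<in>A. \<forall>B\<in>sets borel. B \<subseteq> cdom c \<longrightarrow> emeasure \<mu> B = local_volume c f B)"
  by (simp add: is_vol_def local_volume_def vol_density_def)

lemma vol_density_eq_gram:
  assumes "smooth_atlas A" "c \<in> A" "y \<in> cimg c"
  shows "vol_density c f y = sqrt (det (gram (frechet_derivative (f \<circ> param c) (at y))))"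
  using chart_simps(2)[OF assms]
  by (simp add: vol_density_def pullback_metric_def partial_def dir_deriv_def gram_def)

lemma gram_eq_matrix: "gram L = transpose (matrix L) ** matrix L"
  by (simp add: gram_def matrix_def transpose_def matrix_matrix_mult_def inner_vec_def)

lemma det_gram_compose:
  fixes D :: "real^'m::finite \<Rightarrow> real^'n::finite" and J :: "real^'m \<Rightarrow> real^'m"
  assumes "linear D" "linear J"
  shows "det (gram (\<lambda>v. D (J v))) = (det (matrix J))\<^sup>2 * det (gram D)"
proof -
  have "matrix (\<lambda>v. D (J v)) = matrix D ** matrix J"
    using matrix_compose[OF assms(2,1)] by (simp add: o_def)
  then have "gram (\<lambda>v. D (J v)) = transpose (matrix J) ** (gram D ** matrix J)"
    by (simp add: gram_eq_matrix matrix_transpose_mul matrix_mul_assoc)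
  then show ?thesis by (simp add: det_mul power2_eq_square)
qed

lemma det_gram_scaleR: "det (gram (\<lambda>v. r *\<^sub>R L v)) = (r ^ CARD('m))\<^sup>2 * det (gram (L :: real^'m::finite \<Rightarrow> _))"
proof -
  have "gram (\<lambda>v. r *\<^sub>R L v) = (\<chi> i. (r * r) *s gram L $ i)"
    by (simp add: gram_def vec_eq_iff)
  also have "det \<dots> = (\<Prod>i\<in>(UNIV :: 'm set). r * r) * det (gram L)"
    by (subst det_rows_mul) simp
  finally show ?thesis by (simp add: power_mult_distrib power2_eq_square)
qed

lemma continuous_on_det:
  fixes B :: "'a::topological_space \<Rightarrow> real^'m::finite^'m"
  assumes "\<And>i j. continuous_on S (\<lambda>x. B x $ i $ j)"
  shows "continuous_on S (\<lambda>x. det (B x))"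
  unfolding det_def by (intro continuous_intros assms)

lemma vol_density_continuous:
  assumes A: "smooth_atlas A" and c: "c \<in> A" and f: "f \<in> smooth_functions A"
  shows "continuous_on (cimg c) (vol_density c f)"
proof -
  have "smooth_on (cimg c) (f \<circ> param c)" using f c by (simp add: smooth_functions_def)
  note d = smooth_on_continuous_derivative[OF this]
  have "continuous_on (cimg c) (\<lambda>y. sqrt (det (gram (frechet_derivative (f \<circ> param c) (at y)))))"
    by (intro continuous_on_real_sqrt continuous_on_det) (simp add: gram_def continuous_on_inner d)
  then show ?thesis
    by (rule continuous_on_eq) (simp add: vol_density_eq_gram[OF A c])
qed

lemma coord_image_borel:
  assumes A: "smooth_atlas A" and c: "c \<in> A" and B: "B \<in> sets borel" "B \<subseteq> cdom c"
  shows "coord c ` B = param c -` B \<inter> cimg c" "coord c ` B \<in> sets borel"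
proof -
  show eq: "coord c ` B = param c -` B \<inter> cimg c"
    using chart_simps[OF A c] B(2) by (auto intro: rev_image_eqI)
  have "continuous_on (cimg c) (param c)"
    using smooth_atlasD(3)[OF A c] by (simp add: homeomorphism_def)
  from measurable_sets[OF borel_measurable_continuous_on_restrict[OF this] B(1)]
  have "param c -` B \<inter> cimg c \<in> sets (restrict_space borel (cimg c))"
    by (simp add: space_restrict_space)
  then show "coord c ` B \<in> sets borel"
    unfolding eq using smooth_atlasD(2)[OF A c]
    by (subst (asm) sets_restrict_space_iff) (auto simp: space_restrict_space)
qed

lemma vol_density_measurable:
  assumes "smooth_atlas A" "c \<in> A" "f \<in> smooth_functions A" "Q \<in> sets borel" "Q \<subseteq> cimg c"
  shows "(\<lambda>y. indicator Q y * vol_density c f y) \<in> borel_measurable borel"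
  using borel_measurable_continuous_on_indicator[OF assms(4)
      continuous_on_subset[OF vol_density_continuous[OF assms(1-3)] assms(5)]] by simp

lemma vol_density_nn_measurable:
  assumes "smooth_atlas A" "c \<in> A" "f \<in> smooth_functions A" "Q \<in> sets borel" "Q \<subseteq> cimg c"
  shows "(\<lambda>y. ennreal (vol_density c f y) * indicator Q y) \<in> borel_measurable borel"
proof -
  have "(\<lambda>y. ennreal (vol_density c f y) * indicator Q y) = (\<lambda>y. ennreal (indicator Q y * vol_density c f y))"
    by (auto split: split_indicator)
  then show ?thesis using vol_density_measurable[OF assms] by simp
qed

text \<open>Push the measure with density \<open>vol_density c f\<close> forward along the inverse of the chart.\<close>

lemma local_volume_measure:
  assumes A: "smooth_atlas A" and c: "c \<in> A" and f: "f \<in> smooth_functions A"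
  shows "\<exists>\<nu>. sets \<nu> = sets borel \<and>
    (\<forall>B\<in>sets borel. B \<subseteq> cdom c \<longrightarrow> emeasure \<nu> B = local_volume c f B)"
proof -
  let ?R = "restrict_space lborel (cimg c)"
  let ?\<nu> = "distr (density ?R (\<lambda>y. ennreal (vol_density c f y))) borel (param c)"
  have o: "cimg c \<in> sets borel" using smooth_atlasD(2)[OF A c] by simp
  have dm: "(\<lambda>y. ennreal (vol_density c f y)) \<in> borel_measurable ?R"
    using borel_measurable_continuous_on_restrict[OF vol_density_continuous[OF A c f]]
    by (simp add: measurable_cong_sets[OF sets_restrict_space_cong[OF sets_lborel] refl])
  have pm: "param c \<in> ?R \<rightarrow>\<^sub>M borel"
    using borel_measurable_continuous_on_restrict[of "cimg c" "param c"] smooth_atlasD(3)[OF A c]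
    by (simp add: measurable_cong_sets[OF sets_restrict_space_cong[OF sets_lborel] refl] homeomorphism_def)
  have "emeasure ?\<nu> B = local_volume c f B" if B: "B \<in> sets borel" "B \<subseteq> cdom c" for B
  proof -
    note img = coord_image_borel[OF A c B]
    have sub: "coord c ` B \<subseteq> cimg c" using img(1) by blast
    have inR: "coord c ` B \<in> sets ?R"
      using img(2) sub o by (subst sets_restrict_space_iff) auto
    have "emeasure ?\<nu> B = emeasure (density ?R (\<lambda>y. ennreal (vol_density c f y))) (coord c ` B)"
      using pm B by (subst emeasure_distr) (auto simp: space_restrict_space img(1))
    also have "\<dots> = (\<integral>\<^sup>+y. ennreal (vol_density c f y) * indicator (coord c ` B) y \<partial>?R)"
      by (rule emeasure_density[OF dm inR])
    also have "\<dots> = (\<integral>\<^sup>+y. ennreal (vol_density c f y) * indicator (coord c ` B) y * indicator (cimg c) y \<partial>lborel)"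
      using o by (subst nn_integral_restrict_space) auto
    also have "\<dots> = local_volume c f B"
      unfolding local_volume_def using sub
      by (intro nn_integral_cong) (auto split: split_indicator)
    finally show ?thesis .
  qed
  then show ?thesis by (intro exI[of _ ?\<nu>]) simp
qed

text \<open>If \<open>J\<close> is the Jacobian of the transition map, the Gram determinants in the two charts differ
  by the factor \<open>(det J)\<^sup>2\<close>, so the densities differ by \<open>\<bar>det J\<bar>\<close>, which is the factor in the change
  of variables formula.\<close>

lemma local_volume_chart_independent:
  fixes f :: "'p::topological_space \<Rightarrow> real^'n::finite" and c d :: "('p, 'm::finite) chart"
  assumes A: "smooth_atlas A" and c: "c \<in> A" and d: "d \<in> A" and f: "f \<in> smooth_functions A"
    and B: "B \<in> sets borel" "B \<subseteq> cdom c" "B \<subseteq> cdom d"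
  shows "local_volume c f B = local_volume d f B"
proof -
  let ?U = "coord c ` (cdom c \<inter> cdom d)" and ?g = "coord d \<circ> param c"
  let ?J = "\<lambda>x. frechet_derivative ?g (at x)"
  have g: "smooth_on ?U ?g"
    using A c d by (simp add: smooth_atlas_def compatible_def)
  have "open (cdom c \<inter> cdom d)" using smooth_atlasD(1)[OF A] c d by (intro open_Int)
  then have "openin (top_of_set (cimg c)) ?U"
    by (intro homeomorphism_imp_open_map[OF smooth_atlasD(3)[OF A c]]) (auto simp: openin_open_eq smooth_atlasD[OF A c])
  then have U: "open ?U" using smooth_atlasD(2)[OF A c] openin_open_trans by blast
  have SU: "coord c ` B \<subseteq> ?U" using B by blast
  have gS: "?g ` coord c ` B = coord d ` B"
    using chart_simps(1)[OF A c] B(2) by (force simp: image_iff)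
  have jac: "\<bar>det (matrix (?J x))\<bar> * vol_density d f (?g x) = vol_density c f x" if x: "x \<in> ?U" for x
  proof -
    have xc: "x \<in> cimg c" and pxd: "param c x \<in> cdom d"
      using x chart_simps[OF A c] by auto
    have gx: "?g x \<in> cimg d" using chart_simps(3)[OF A d pxd] by simp
    have dg: "(?g has_derivative ?J x) (at x)"
      by (rule smooth_on_differentiable[OF g U x])
    let ?D = "frechet_derivative (f \<circ> param d) (at (?g x))"
    have df: "((f \<circ> param d) has_derivative ?D) (at (?g x))"
      using f d smooth_atlasD(2)[OF A d] gx
      by (intro smooth_on_differentiable) (auto simp: smooth_functions_def)
    have "((\<lambda>z. (f \<circ> param d) (?g z)) has_derivative (\<lambda>v. ?D (?J x v))) (at x)"
      by (rule has_derivative_compose[OF dg df])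
    moreover have "(f \<circ> param d) (?g z) = (f \<circ> param c) z" if "z \<in> ?U" for z
      using that chart_simps[OF A c] chart_simps[OF A d] by auto
    ultimately have "((f \<circ> param c) has_derivative (\<lambda>v. ?D (?J x v))) (at x)"
      using U x by (blast intro: has_derivative_transform_within_open)
    then have "frechet_derivative (f \<circ> param c) (at x) = (\<lambda>v. ?D (?J x v))"
      by (rule frechet_derivative_at[symmetric])
    then have "vol_density c f x = sqrt ((det (matrix (?J x)))\<^sup>2 * det (gram ?D))"
      using det_gram_compose[OF has_derivative_linear[OF df] has_derivative_linear[OF dg]]
      by (simp add: vol_density_eq_gram[OF A c xc])
    then show ?thesis
      unfolding vol_density_eq_gram[OF A d gx] by (simp add: real_sqrt_mult)
  qed
  note bc = coord_image_borel[OF A c B(1,2)] and bd = coord_image_borel[OF A d B(1,3)]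
  have cong: "indicator (coord c ` B) x * (\<bar>det (matrix (?J x))\<bar> * vol_density d f (?g x)) =
      indicator (coord c ` B) x * vol_density c f x" for x
    using jac SU by (auto split: split_indicator)
  have "local_volume d f B = (\<integral>\<^sup>+y. ennreal (vol_density d f y) * indicator (?g ` coord c ` B) y \<partial>lborel)"
    unfolding gS local_volume_def ..
  also have "\<dots> = (\<integral>\<^sup>+x. ennreal (\<bar>det (matrix (?J x))\<bar> * vol_density d f (?g x)) * indicator (coord c ` B) x \<partial>lborel)"
  proof (rule nn_integral_change_of_variables)
    show "coord c ` B \<in> sets borel" "?g ` coord c ` B \<in> sets borel"
      unfolding gS by (fact bc(2), fact bd(2))
    show "(?g has_derivative ?J x) (at x)" if "x \<in> coord c ` B" for x
      using smooth_on_differentiable[OF g U] that SU by blast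
    show "inj_on ?g (coord c ` B)"
    proof (rule inj_onI)
      fix a b assume "a \<in> coord c ` B" "b \<in> coord c ` B" and e: "?g a = ?g b"
      then obtain q q' where q: "q \<in> B" "a = coord c q" and q': "q' \<in> B" "b = coord c q'" by blast
      have "q \<in> cdom c" "q' \<in> cdom c" using q(1) q'(1) B(2) by blast+
      then have "coord d q = coord d q'"
        using e chart_simps(1)[OF A c] q(2) q'(2) by simp
      then have "q = q'" using chart_simps(1)[OF A d] q(1) q'(1) B(3) by (metis subsetD)
      then show "a = b" using q q' by simp
    qed
    show "(\<lambda>y. indicator (?g ` coord c ` B) y * vol_density d f y) \<in> borel_measurable borel"
      unfolding gS by (rule vol_density_measurable[OF A d f bd(2)]) (use bd(1) in blast)
    show "(\<lambda>x. indicator (coord c ` B) x * (\<bar>det (matrix (?J x))\<bar> * vol_density d f (?g x)))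
        \<in> borel_measurable borel"
      unfolding cong by (rule vol_density_measurable[OF A c f bc(2)]) (use bc(1) in blast)
  qed
  also have "\<dots> = local_volume c f B"
    unfolding local_volume_def using jac SU
    by (intro nn_integral_cong) (auto split: split_indicator)
  finally show ?thesis ..
qed


text \<open>A finite sum of restrictions of measures. When the \<open>E i\<close> partition the space, this glues the
  measures \<open>\<nu> i\<close> together.\<close>

lemma patched_measure:
  fixes \<nu> :: "nat \<Rightarrow> 'a measure" and E :: "nat \<Rightarrow> 'a set"
  assumes \<nu>: "\<And>i. i < N \<Longrightarrow> sets (\<nu> i) = sets M" and E: "\<And>i. E i \<in> sets M"
  shows "\<exists>\<mu>. sets \<mu> = sets M \<and> (\<forall>B\<in>sets M. emeasure \<mu> B = (\<Sum>i<N. emeasure (\<nu> i) (B \<inter> E i)))"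
proof -
  let ?m = "\<lambda>B. \<Sum>i<N. emeasure (\<nu> i) (B \<inter> E i)"
  let ?\<mu> = "measure_of (space M) (sets M) ?m"
  have "countably_additive (sets M) ?m"
  proof (rule countably_additiveI)
    fix X :: "nat \<Rightarrow> 'a set" assume X: "range X \<subseteq> sets M" "disjoint_family X"
    have "(\<Sum>n. ?m (X n)) = (\<Sum>i<N. \<Sum>n. emeasure (\<nu> i) (X n \<inter> E i))"
      by (rule suminf_sum) auto
    also have "\<dots> = (\<Sum>i<N. emeasure (\<nu> i) (\<Union>n. X n \<inter> E i))"
    proof (rule sum.cong[OF refl])
      fix i assume "i \<in> {..<N}"
      then show "(\<Sum>n. emeasure (\<nu> i) (X n \<inter> E i)) = emeasure (\<nu> i) (\<Union>n. X n \<inter> E i)"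
        using X \<nu>[of i] E[of i]
        by (intro suminf_emeasure) (auto simp: disjoint_family_on_def)
    qed
    also have "\<dots> = ?m (\<Union>n. X n)" by simp
    finally show "(\<Sum>n. ?m (X n)) = ?m (\<Union>n. X n)" .
  qed
  then have "emeasure ?\<mu> B = ?m B" if "B \<in> sets M" for B
    using that by (intro emeasure_measure_of_sigma sets.sigma_algebra_axioms) (auto simp: positive_def)
  then show ?thesis by (intro exI[of _ ?\<mu>]) auto
qed

lemma finite_chart_partition:
  fixes A :: "('p::topological_space, 'm::finite) chart set"
  assumes cpt: "compact (UNIV :: 'p set)" and A: "smooth_atlas A"
  shows "\<exists>(N::nat) e E. (\<forall>i<N. e i \<in> A \<and> E i \<subseteq> cdom (e i)) \<and> (\<forall>i. E i \<in> sets borel) \<and>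
    disjoint_family E \<and> (\<Union>i<N. E i) = UNIV"
proof -
  obtain F where F: "F \<subseteq> A" "finite F" "(\<Union>c\<in>F. cdom c) = UNIV"
    using compactE_image[OF cpt, of A cdom] smooth_atlasD(1)[OF A] A
    unfolding smooth_atlas_def by (metis top.extremum_unique)
  obtain e where e: "bij_betw e {0..<card F} F"
    using ex_bij_betw_nat_finite[OF F(2)] by blast
  let ?D = "\<lambda>i. if i < card F then cdom (e i) else {}"
  let ?E = "disjointed ?D"
  have eA: "e i \<in> A" if "i < card F" for i
    using that e F(1) by (auto simp: bij_betw_def)
  have "?E i \<subseteq> cdom (e i)" if "i < card F" for i
    using disjointed_subset[of ?D i] that by simp
  moreover have "?E i \<in> sets borel" for i
  proof -
    have "?D i \<in> sets borel" for i using smooth_atlasD(1)[OF A eA] by auto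
    then have "range ?E \<subseteq> sets borel"
      using sets.range_disjointed_sets[of ?D borel] by blast
    then show ?thesis by blast
  qed
  moreover have "(\<Union>i<card F. ?E i) = UNIV"
  proof -
    have "(\<Union>i<card F. ?E i) = (\<Union>i<card F. ?D i)"
      using finite_UN_disjointed_eq[of ?D "card F"] by (simp add: atLeast0LessThan)
    also have "\<dots> = (\<Union>c\<in>e ` {0..<card F}. cdom c)" by (auto simp: atLeast0LessThan)
    also have "\<dots> = UNIV" using e F(3) by (simp add: bij_betw_def)
    finally show ?thesis .
  qed
  ultimately show ?thesis
    using eA disjoint_family_disjointed[of ?D]
    by (intro exI[of _ "card F"] exI[of _ e] exI[of _ ?E] conjI allI impI)
qed

lemma emeasure_partition:
  assumes \<mu>: "sets \<mu> = sets borel" and B: "B \<in> sets borel" and E: "\<And>i. E i \<in> sets borel"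
    and dis: "disjoint_family E" and cov: "(\<Union>i<N. E i) = UNIV"
  shows "emeasure \<mu> B = (\<Sum>i<N. emeasure \<mu> (B \<inter> E (i::nat)))"
proof -
  have "(\<Sum>i<N. emeasure \<mu> (B \<inter> E i)) = emeasure \<mu> (\<Union>i<N. B \<inter> E i)"
    using \<mu> B E dis by (intro sum_emeasure) (fastforce simp: disjoint_family_on_def)+
  also have "(\<Union>i<N. B \<inter> E i) = B" using cov by blast
  finally show ?thesis ..
qed

text \<open>The volume is defined by a definite description, so nothing can be computed before it is
  known to exist uniquely. Compactness gives a finite Borel partition into pieces of chart domains.
  A volume measure is determined by its values on the pieces, and gluing the measures of the
  charts along them gives one because these measures agree on overlaps.\<close>

lemma is_vol_vol:
  fixes A :: "('p::topological_space, 'm::finite) chart set" and f :: "'p \<Rightarrow> real^'n::finite"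
  assumes cpt: "compact (UNIV :: 'p set)" and A: "smooth_atlas A" and f: "f \<in> smooth_functions A"
  shows ex1_vol: "\<exists>!\<mu>. is_vol A f \<mu>" and "is_vol A f (vol A f)"
proof -
  obtain N :: nat and e E where eE: "\<forall>i<N. e i \<in> A \<and> E i \<subseteq> cdom (e i)" "\<forall>i. E i \<in> sets borel"
    and dis: "disjoint_family E" and cov: "(\<Union>i<N. E i) = UNIV"
    using finite_chart_partition[OF cpt A] by (elim exE conjE)
  have e: "e i \<in> A" and Ee: "E i \<subseteq> cdom (e i)" if "i < N" for i using eE(1) that by blast+
  have E: "E i \<in> sets borel" for i using eE(2) ..
  have "\<forall>c\<in>A. \<exists>\<nu>. sets \<nu> = sets borel \<and>
      (\<forall>B\<in>sets borel. B \<subseteq> cdom c \<longrightarrow> emeasure \<nu> B = local_volume c f B)"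
    using local_volume_measure[OF A _ f] by blast
  then obtain \<nu> where \<nu>: "\<And>c. c \<in> A \<Longrightarrow> sets (\<nu> c) = sets borel"
    "\<And>c B. c \<in> A \<Longrightarrow> B \<in> sets borel \<Longrightarrow> B \<subseteq> cdom c \<Longrightarrow> emeasure (\<nu> c) B = local_volume c f B"
    by metis
  obtain \<mu> where \<mu>: "sets \<mu> = sets borel"
    "\<And>B. B \<in> sets borel \<Longrightarrow> emeasure \<mu> B = (\<Sum>i<N. emeasure (\<nu> (e i)) (B \<inter> E i))"
    using patched_measure[of N "\<lambda>i. \<nu> (e i)" borel E] \<nu>(1)[OF e] E by auto
  have "emeasure \<mu> B = local_volume c f B" if c: "c \<in> A" and B: "B \<in> sets borel" "B \<subseteq> cdom c" for c B
  proof -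
    have "emeasure (\<nu> (e i)) (B \<inter> E i) = emeasure (\<nu> c) (B \<inter> E i)" if i: "i < N" for i
    proof -
      have "B \<inter> E i \<in> sets borel" "B \<inter> E i \<subseteq> cdom (e i)" "B \<inter> E i \<subseteq> cdom c"
        using B E[of i] Ee[OF i] by auto
      then show ?thesis
        using \<nu>(2)[OF e[OF i]] \<nu>(2)[OF c] local_volume_chart_independent[OF A e[OF i] c f] by simp
    qed
    then have "emeasure \<mu> B = (\<Sum>i<N. emeasure (\<nu> c) (B \<inter> E i))"
      using \<mu>(2)[OF B(1)] by simp
    also have "\<dots> = emeasure (\<nu> c) B"
      using emeasure_partition[OF \<nu>(1)[OF c] B(1) E dis cov] by simp
    finally show ?thesis using \<nu>(2)[OF c B] by simp
  qed
  with \<mu>(1) have vol: "is_vol A f \<mu>" by (simp add: is_vol_iff)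
  have "\<mu>' = \<mu>" if "is_vol A f \<mu>'" for \<mu>'
  proof (rule measure_eqI)
    have s': "sets \<mu>' = sets borel" using that by (simp add: is_vol_iff)
    then show "sets \<mu>' = sets \<mu>" using \<mu>(1) by simp
    fix B assume "B \<in> sets \<mu>'"
    then have B: "B \<in> sets borel" using s' by simp
    have "emeasure \<mu>' (B \<inter> E i) = emeasure \<mu> (B \<inter> E i)" if i: "i < N" for i
    proof -
      have "B \<inter> E i \<in> sets borel" "B \<inter> E i \<subseteq> cdom (e i)" using B E[of i] Ee[OF i] by auto
      then show ?thesis
        using vol \<open>is_vol A f \<mu>'\<close> e[OF i] by (simp add: is_vol_iff)
    qed
    then show "emeasure \<mu>' B = emeasure \<mu> B"
      using emeasure_partition[OF s' B E dis cov] emeasure_partition[OF \<mu>(1) B E dis cov] by simp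
  qed
  with vol show ex1: "\<exists>!\<mu>. is_vol A f \<mu>" by blast
  show "is_vol A f (vol A f)" unfolding vol_def by (rule theI'[OF ex1])
qed

text \<open>The density is continuous, hence bounded near every point in a chart; finitely many such
  neighbourhoods cover the manifold.\<close>

lemma vol_finite:
  fixes A :: "('p::topological_space, 'm::finite) chart set" and f :: "'p \<Rightarrow> real^'n::finite"
  assumes cpt: "compact (UNIV :: 'p set)" and A: "smooth_atlas A" and f: "f \<in> smooth_functions A"
  shows "finite_measure (vol A f)"
proof -
  note vol = is_vol_vol(2)[OF cpt A f, unfolded is_vol_iff]
  have "\<exists>V. x \<in> V \<and> open V \<and> emeasure (vol A f) V < \<infinity>" for x
  proof -
    obtain c where c: "c \<in> A" "x \<in> cdom c" using smooth_atlas_covers[OF A] .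
    let ?y = "coord c x"
    have "?y \<in> cimg c" using chart_simps(3)[OF A c] .
    then obtain r where r: "r > 0" "cball ?y r \<subseteq> cimg c"
      using smooth_atlasD(2)[OF A c(1)] open_contains_cball by blast
    have "compact (vol_density c f ` cball ?y r)"
      using continuous_on_subset[OF vol_density_continuous[OF A c(1) f] r(2)]
      by (rule compact_continuous_image) simp
    then obtain K where K: "\<forall>y\<in>cball ?y r. \<bar>vol_density c f y\<bar> \<le> K"
      by (auto dest!: compact_imp_bounded simp: bounded_iff simp del: mem_cball)
    have le: "vol_density c f y \<le> K" if "y \<in> ball ?y r" for y
      using K[rule_format, of y] that by simp
    let ?V = "param c ` ball ?y r"
    have ballc: "ball ?y r \<subseteq> cimg c" using r(2) by auto
    have "openin (top_of_set (cdom c)) ?V"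
      using smooth_atlasD[OF A c(1)] ballc
      by (intro homeomorphism_imp_open_map[OF homeomorphism_symD]) (auto simp: openin_open_eq)
    then have oV: "open ?V" using smooth_atlasD(1)[OF A c(1)] openin_open_trans by blast
    have Vc: "?V \<subseteq> cdom c" using ballc chart_simps(4)[OF A c(1)] by blast
    have img: "coord c ` ?V = ball ?y r"
      using ballc chart_simps(2)[OF A c(1)] by (force simp: image_iff)
    have "emeasure (vol A f) ?V = local_volume c f ?V"
      using vol c(1) oV Vc by simp
    also have "\<dots> \<le> (\<integral>\<^sup>+y. ennreal K * indicator (ball ?y r) y \<partial>lborel)"
      unfolding local_volume_def img
      by (intro nn_integral_mono) (auto intro!: ennreal_leI le split: split_indicator)
    also have "\<dots> = ennreal K * emeasure lborel (ball ?y r)"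
      by (simp add: nn_integral_cmult_indicator)
    also have "\<dots> < \<infinity>"
      using emeasure_bounded_finite[of "ball ?y r"] by (simp add: ennreal_mult_less_top)
    finally have "emeasure (vol A f) ?V < \<infinity>" .
    moreover have "x \<in> ?V"
      using chart_simps(1)[OF A c(1,2)] r(1) by (intro image_eqI[where x = ?y]) simp_all
    ultimately show ?thesis using oV by blast
  qed
  then obtain V where V: "\<And>x. x \<in> V x" "\<And>x. open (V x)" "\<And>x. emeasure (vol A f) (V x) < \<infinity>"
    by metis
  obtain X where X: "finite X" "UNIV \<subseteq> (\<Union>x\<in>X. V x)"
    using compactE_image[OF cpt, of UNIV V] V(1,2) by (metis UNIV_I UN_I subsetI)
  have sets: "sets (vol A f) = sets borel" using vol by simp
  then have space: "space (vol A f) = UNIV" using sets_eq_imp_space_eq[OF sets] by simp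
  have "emeasure (vol A f) (\<Union>x\<in>X. V x) \<le> (\<Sum>x\<in>X. emeasure (vol A f) (V x))"
    using V(2) sets X(1) by (intro emeasure_subadditive_finite) auto
  also have "\<dots> < \<infinity>" using V(3) X(1) by (simp add: less_top)
  finally have "emeasure (vol A f) UNIV < \<infinity>" using X(2) by (simp add: top.extremum_unique)
  then show ?thesis by (intro finite_measureI) (simp add: space)
qed

text \<open>Homothety by \<open>r\<close> multiplies the Gram matrix by \<open>r\<^sup>2\<close> and its determinant by \<open>r\<close> to the power
  \<open>2 CARD('m)\<close>. Uniqueness of the volume turns this into an equality of measures.\<close>

lemma vol_scale_translate:
  fixes A :: "('p::topological_space, 'm::finite) chart set" and f :: "'p \<Rightarrow> real^'n::finite"
  assumes cpt: "compact (UNIV :: 'p set)" and A: "smooth_atlas A" and f: "f \<in> smooth_functions A"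
    and r: "0 \<le> r"
  shows "vol A (\<lambda>x. r *\<^sub>R f x + b) = scale_measure (ennreal (r ^ CARD('m))) (vol A f)"
proof -
  let ?h = "\<lambda>x. r *\<^sub>R f x + b"
  have h: "?h \<in> smooth_functions A"
    by (rule smooth_functions_scale_translate[OF A f])
  note vol = is_vol_vol(2)[OF cpt A f, unfolded is_vol_iff]
  have dens: "vol_density c ?h y = r ^ CARD('m) * vol_density c f y" if c: "c \<in> A" and y: "y \<in> cimg c" for c y
  proof -
    let ?D = "frechet_derivative (f \<circ> param c) (at y)"
    have "((f \<circ> param c) has_derivative ?D) (at y)"
      using f c y smooth_atlasD(2)[OF A c]
      by (intro smooth_on_differentiable[of "cimg c"]) (simp_all add: smooth_functions_def)
    then have "((\<lambda>y. r *\<^sub>R (f \<circ> param c) y + b) has_derivative (\<lambda>v. r *\<^sub>R ?D v + 0)) (at y)"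
      by (intro has_derivative_add has_derivative_const has_derivative_scaleR_right)
    then have "frechet_derivative (?h \<circ> param c) (at y) = (\<lambda>v. r *\<^sub>R ?D v)"
      by (intro frechet_derivative_at[symmetric]) (simp add: o_def)
    then show ?thesis
      using r by (simp add: vol_density_eq_gram[OF A c y] det_gram_scaleR real_sqrt_mult)
  qed
  have "local_volume c ?h B = ennreal (r ^ CARD('m)) * local_volume c f B"
    if c: "c \<in> A" and B: "B \<in> sets borel" "B \<subseteq> cdom c" for c B
  proof -
    note img = coord_image_borel[OF A c B]
    have sub: "coord c ` B \<subseteq> cimg c" using img(1) by blast
    have "local_volume c ?h B =
        (\<integral>\<^sup>+y. ennreal (r ^ CARD('m)) * (ennreal (vol_density c f y) * indicator (coord c ` B) y) \<partial>lborel)"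
      unfolding local_volume_def using sub r
      by (intro nn_integral_cong) (auto simp: dens[OF c] ennreal_mult' split: split_indicator)
    also have "\<dots> = ennreal (r ^ CARD('m)) * local_volume c f B"
      unfolding local_volume_def
      using vol_density_nn_measurable[OF A c f img(2) sub] by (intro nn_integral_cmult) simp
    finally show ?thesis .
  qed
  then have "is_vol A ?h (scale_measure (ennreal (r ^ CARD('m))) (vol A f))"
    using vol by (simp add: is_vol_iff)
  then show ?thesis
    using ex1_vol[OF cpt A h] is_vol_vol(2)[OF cpt A h] by blast
qed

section \<open>Sobolev norms of constant fields\<close>

context
  fixes A :: "('p::t2_space, 'm::finite) chart set"
  assumes cpt: "compact (UNIV :: 'p set)" and A: "smooth_atlas A"
begin

lemma smooth_functions_bounded:
  assumes "f \<in> smooth_functions A" shows "\<exists>K. \<forall>x. norm (f x) \<le> K"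
  using compact_imp_bounded[OF compact_continuous_image[OF smooth_functions_continuous[OF A assms] cpt]]
  by (auto simp: bounded_iff)

lemma integrable_inner_smooth:
  fixes f h k :: "'p \<Rightarrow> real^'n::finite"
  assumes f: "f \<in> smooth_functions A" and h: "h \<in> smooth_functions A" and k: "k \<in> smooth_functions A"
  shows "integrable (vol A f) (\<lambda>x. h x \<bullet> k x)"
proof -
  interpret finite_measure "vol A f" by (rule vol_finite[OF cpt A f])
  have sets: "sets (vol A f) = sets borel" using is_vol_vol(2)[OF cpt A f] by (simp add: is_vol_iff)
  have cont: "continuous_on UNIV (\<lambda>x. h x \<bullet> k x)"
    by (intro continuous_on_inner smooth_functions_continuous[OF A] h k)
  have "bounded (range (\<lambda>x. h x \<bullet> k x))"
    by (rule compact_imp_bounded[OF compact_continuous_image[OF cont cpt]])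
  then obtain K where "\<And>x. norm (h x \<bullet> k x) \<le> K"
    by (auto simp: bounded_iff)
  then show ?thesis
    using borel_measurable_continuous_onI[OF cont]
    by (intro integrable_const_bound[of _ K]) (simp_all add: measurable_cong_sets[OF sets refl])
qed

lemma L2_inner_const:
  fixes f :: "'p \<Rightarrow> real^'n::finite"
  shows
  "L2_inner A f (\<lambda>x. l) (\<lambda>x. l) = (norm l)\<^sup>2 * measure (vol A f) (space (vol A f))"
  by (simp add: L2_inner_def power2_norm_eq_inner)

text \<open>Pairing \<open>\<Delta>u = \<mu>u\<close> with a constant gives \<open>\<mu>\<langle>u, l\<rangle> = \<langle>\<nabla>u, \<nabla>l\<rangle> = 0\<close>.\<close>

lemma L2_inner_eigenvector_const:
  fixes f :: "'p \<Rightarrow> real^'n::finite"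
  assumes u: "u \<in> eigenspace A f \<mu>" and \<mu>: "\<mu> \<noteq> 0"
  shows "L2_inner A f (\<lambda>x. l) u = 0"
proof -
  have "nabla_inner A f u (\<lambda>x. l) = (\<lambda>x. 0)"
    by (simp add: nabla_inner_def Let_def partial_def dir_deriv_def o_def fun_eq_iff)
  then have "L2_inner A f (\<lambda>x. \<mu> *\<^sub>R u x) (\<lambda>x. l) = 0"
    using u smooth_functions_const[OF A, of l]
    by (simp add: eigenspace_def has_bochner_laplacian_def)
  then show ?thesis
    using \<mu> by (simp add: L2_inner_def inner_commute)
qed

lemma zero_in_eigenspace:
  fixes f :: "'p \<Rightarrow> real^'n::finite"
  shows "(\<lambda>x. 0) \<in> eigenspace A f \<mu>"
  using smooth_functions_const[OF A, of "0 :: real^'n"]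
  by (simp add: eigenspace_def has_bochner_laplacian_def L2_inner_def nabla_inner_def Let_def
      partial_def dir_deriv_def o_def)

text \<open>Nondegeneracy of the \<open>L\<^sup>2\<close> product on smooth functions comes for free from the positivity of
  \<open>P\<close>: a function that vanishes almost everywhere pairs to zero with \<open>P u\<close>.\<close>

lemma L2_null_imp_zero:
  fixes P :: "('p \<Rightarrow> real^'n::finite) \<Rightarrow> ('p \<Rightarrow> real^'n) \<Rightarrow> 'p \<Rightarrow> real^'n"
    and f u :: "'p \<Rightarrow> real^'n"
  assumes P: "sobolev_type_operator A P" and f: "f \<in> Imm A" and u: "u \<in> smooth_functions A"
    and null: "L2_inner A f u u = 0"
  shows "u = (\<lambda>x. 0)"
proof (rule ccontr)
  assume "u \<noteq> (\<lambda>x. 0)"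
  then have pos: "L2_inner A f (P f u) u > 0"
    using P f u unfolding sobolev_type_operator_def by blast
  have "AE x in vol A f. u x \<bullet> u x = 0"
    using null integrable_inner_smooth[OF _ u u, of f] f
    by (subst (asm) L2_inner_def) (simp add: integral_nonneg_eq_0_iff_AE Imm_def)
  then have "AE x in vol A f. P f u x \<bullet> u x = 0" by eventually_elim simp
  then have "L2_inner A f (P f u) u = 0"
    unfolding L2_inner_def by (rule integral_eq_zero_AE)
  with pos show False by simp
qed

text \<open>Zero satisfies the description of the projection because constants are orthogonal to the
  eigenspace. Any other candidate \<open>u\<close>, tested against itself, has \<open>\<langle>u, u\<rangle> = \<langle>l, u\<rangle> = 0\<close>.\<close>

lemma eigenprojection_const:
  fixes P :: "('p \<Rightarrow> real^'n::finite) \<Rightarrow> ('p \<Rightarrow> real^'n) \<Rightarrow> 'p \<Rightarrow> real^'n"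
    and f :: "'p \<Rightarrow> real^'n"
  assumes P: "sobolev_type_operator A P" and f: "f \<in> Imm A" and \<mu>: "\<mu> \<noteq> 0"
  shows "eigenprojection A f \<mu> (\<lambda>x. l) = (\<lambda>x. 0)"
  unfolding eigenprojection_def
proof (rule the_equality)
  show "(\<lambda>x. 0) \<in> eigenspace A f \<mu> \<and> (\<forall>v\<in>eigenspace A f \<mu>. L2_inner A f (\<lambda>x. l - 0) v = 0)"
    using zero_in_eigenspace[of f \<mu>] L2_inner_eigenvector_const[OF _ \<mu>, of _ f l] by simp
next
  fix u assume u: "u \<in> eigenspace A f \<mu> \<and> (\<forall>v\<in>eigenspace A f \<mu>. L2_inner A f (\<lambda>x. l - u x) v = 0)"
  have us: "u \<in> smooth_functions A" and fs: "f \<in> smooth_functions A"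
    using u f by (auto simp: eigenspace_def has_bochner_laplacian_def Imm_def)
  have "L2_inner A f (\<lambda>x. l - u x) u = L2_inner A f (\<lambda>x. l) u - L2_inner A f u u"
    unfolding L2_inner_def inner_diff_left
    by (intro Bochner_Integration.integral_diff integrable_inner_smooth[OF fs _ us] us
        smooth_functions_const A)
  then have "L2_inner A f u u = 0"
    using u L2_inner_eigenvector_const[OF _ \<mu>, of u f l] by simp
  then show "u = (\<lambda>x. 0)" by (rule L2_null_imp_zero[OF P f us])
qed

text \<open>For \<open>p \<noteq> 0\<close> every term of the series for \<open>\<Delta>\<^sup>p l\<close> vanishes: the coefficient if \<open>\<mu> = 0\<close>, the
  projection otherwise. For \<open>p = 0\<close> the operator \<open>1 + \<Delta>\<^sup>p\<close> is multiplication by 2, which is where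
  the factor 2 in the bound comes from.\<close>

lemma Hp_norm_const_le:
  fixes P :: "('p \<Rightarrow> real^'n::finite) \<Rightarrow> ('p \<Rightarrow> real^'n) \<Rightarrow> 'p \<Rightarrow> real^'n"
    and f :: "'p \<Rightarrow> real^'n"
  assumes P: "sobolev_type_operator A P" and f: "f \<in> Imm A"
  shows "\<bar>Hp_norm A p f (\<lambda>x. l)\<bar> \<le> norm l * sqrt (2 * measure (vol A f) (space (vol A f)))"
proof (cases "p = 0")
  case True
  have "Hp_norm A p f (\<lambda>x. l) = sqrt (L2_inner A f (\<lambda>x. l + l) (\<lambda>x. l))"
    using True unfolding Hp_norm_def laplacian_power_def by (simp only: refl if_True)
  also have "L2_inner A f (\<lambda>x. l + l) (\<lambda>x. l) = 2 * L2_inner A f (\<lambda>x. l) (\<lambda>x. l)"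
    unfolding L2_inner_def inner_add_left by (simp add: algebra_simps)
  finally have "Hp_norm A p f (\<lambda>x. l) = sqrt ((norm l)\<^sup>2 * (2 * measure (vol A f) (space (vol A f))))"
    by (simp add: L2_inner_const)
  then show ?thesis by (simp add: real_sqrt_mult abs_mult)
next
  case False
  have summand: "(\<mu> powr p) *\<^sub>R eigenprojection A f \<mu> (\<lambda>x. l) x = 0" for \<mu> x
    using eigenprojection_const[OF P f, of \<mu> l] by (cases "\<mu> = 0") simp_all
  have "laplacian_power A f p (\<lambda>x. l) = (\<lambda>x. 0)"
    using False by (simp add: laplacian_power_def summand)
  then have "\<bar>Hp_norm A p f (\<lambda>x. l)\<bar> = sqrt ((norm l)\<^sup>2 * measure (vol A f) (space (vol A f)))"
    by (simp add: Hp_norm_def L2_inner_const)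
  also have "\<dots> \<le> sqrt ((norm l)\<^sup>2 * (2 * measure (vol A f) (space (vol A f))))"
    by (intro real_sqrt_le_mono mult_left_mono) simp_all
  finally show ?thesis by (simp add: real_sqrt_mult)
qed

section \<open>Lengths of paths of shapes\<close>

lemma vertical_smooth:
  fixes f :: "'p \<Rightarrow> real^'n::finite"
  assumes f: "f \<in> smooth_functions A" and v: "v \<in> vertical A f"
  shows "v \<in> smooth_functions A"
proof -
  obtain X where X: "X \<in> vector_fields A" "v = (\<lambda>x. \<chi> i. X (\<lambda>q. f q $ i) x)"
    using v by (auto simp: vertical_def)
  have "(\<lambda>q. f q $ i) \<in> smooth_functions A" for i
    by (rule smooth_functions_linear[OF A bounded_linear_vec_nth f])
  then have "X (\<lambda>q. f q $ i) \<in> smooth_functions A" for i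
    using X(1) by (simp add: vector_fields_def)
  then show ?thesis unfolding X(2) by (rule smooth_functions_vec[OF A])
qed

lemma zero_vertical:
  fixes f :: "'p \<Rightarrow> real^'n::finite"
  shows "(\<lambda>x. 0) \<in> vertical A f"
proof -
  have "(\<lambda>a x. 0) \<in> vector_fields A"
    using smooth_functions_const[OF A, of "0::real"] by (simp add: vector_fields_def)
  moreover have "(\<lambda>x. 0 :: real^'n) = (\<lambda>x. \<chi> i. (\<lambda>a x. 0 :: real) (\<lambda>q. f q $ i) x)"
    by (simp add: vec_eq_iff fun_eq_iff)
  ultimately show ?thesis
    unfolding vertical_def mem_Collect_eq by (intro exI[of _ "\<lambda>a x. 0"] conjI)
qed

lemma GP_norm_nonneg:
  fixes P :: "('p \<Rightarrow> real^'n::finite) \<Rightarrow> ('p \<Rightarrow> real^'n) \<Rightarrow> 'p \<Rightarrow> real^'n"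
    and f h :: "'p \<Rightarrow> real^'n"
  assumes "sobolev_type_operator A P" "f \<in> Imm A" "h \<in> smooth_functions A"
  shows "0 \<le> GP_norm A P f h"
proof (cases "h = (\<lambda>x. 0)")
  case False
  then have "L2_inner A f (P f h) h > 0"
    using assms unfolding sobolev_type_operator_def by blast
  then show ?thesis by (simp add: GP_norm_def)
qed (simp add: GP_norm_def L2_inner_def)

text \<open>Vertical vectors are smooth, so the infimum runs over nonnegative numbers; it is bounded by
  the value at the zero vertical vector.\<close>

lemma quotient_norm_bounds:
  fixes P :: "('p \<Rightarrow> real^'n::finite) \<Rightarrow> ('p \<Rightarrow> real^'n) \<Rightarrow> 'p \<Rightarrow> real^'n"
    and f h :: "'p \<Rightarrow> real^'n"
  assumes P: "sobolev_type_operator A P" and f: "f \<in> Imm A" and h: "h \<in> smooth_functions A"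
  shows "0 \<le> quotient_norm A P f h" "quotient_norm A P f h \<le> GP_norm A P f h"
proof -
  have fs: "f \<in> smooth_functions A" using f by (simp add: Imm_def)
  have nn: "0 \<le> GP_norm A P f (\<lambda>x. h x - v x)" if "v \<in> vertical A f" for v
    by (intro GP_norm_nonneg P f smooth_functions_diff A h vertical_smooth[OF fs that])
  show "0 \<le> quotient_norm A P f h"
    unfolding quotient_norm_def using zero_vertical nn by (intro cINF_greatest) blast+
  have "quotient_norm A P f h \<le> GP_norm A P f (\<lambda>x. h x - 0)"
    unfolding quotient_norm_def using nn
    by (intro cINF_lower[OF _ zero_vertical] bdd_belowI2[of _ 0]) auto
  then show "quotient_norm A P f h \<le> GP_norm A P f h" by simp
qed

text \<open>Nonnegative lengths exclude the negative constants \<open>C'\<close>: a negative multiple of a distance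
  cannot bound a positive number.\<close>

lemma shape_path_length_nonneg:
  fixes P :: "('p \<Rightarrow> real^'n::finite) \<Rightarrow> ('p \<Rightarrow> real^'n) \<Rightarrow> 'p \<Rightarrow> real^'n"
  assumes "sobolev_type_operator A P" and "is_shape_path A F F0 F1"
  shows "0 \<le> shape_path_length A P F"
proof -
  have "0 \<le> quotient_norm A P (F t) (\<lambda>x. vector_derivative (\<lambda>s. F s x) (at t))" if "t \<in> {0..1}" for t
    using assms that smooth_curve_velocity[OF A, of F t]
    by (intro quotient_norm_bounds) (auto simp: is_shape_path_def)
  then show ?thesis
    unfolding shape_path_length_def
    by (cases "(\<lambda>t. quotient_norm A P (F t) (\<lambda>x. vector_derivative (\<lambda>s. F s x) (at t))) integrable_on {0..1}")
       (auto intro: integral_nonneg simp: not_integrable_integral)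
qed

text \<open>The integral of a non-integrable function is 0 by convention; \<open>0 \<le> B\<close> takes care of this
  case.\<close>

lemma shape_path_length_le:
  assumes "\<And>t. t \<in> {0..1} \<Longrightarrow>
      quotient_norm A P (F t) (\<lambda>x. vector_derivative (\<lambda>s. F s x) (at t)) \<le> B" and "0 \<le> B"
  shows "shape_path_length A P F \<le> B"
proof (cases "(\<lambda>t. quotient_norm A P (F t) (\<lambda>x. vector_derivative (\<lambda>s. F s x) (at t))) integrable_on {0..1}")
  case True
  have "shape_path_length A P F \<le> integral {0..1} (\<lambda>t::real. B)"
    unfolding shape_path_length_def by (rule integral_le[OF True _ assms(1)]) auto
  then show ?thesis by simp
qed (use assms(2) in \<open>simp add: shape_path_length_def not_integrable_integral\<close>)

section \<open>Translating small shapes\<close>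

lemma id_Diff: "id \<in> Diff A"
proof -
  have "smooth_self_map A id"
    using A by (auto simp: smooth_self_map_def smooth_atlas_def compatible_def o_def)
  then show ?thesis by (simp add: Diff_def)
qed

lemma Imm_scale_translate:
  fixes f :: "'p \<Rightarrow> real^'n::finite"
  assumes f: "f \<in> Imm A" and r: "r \<noteq> 0"
  shows "(\<lambda>x. r *\<^sub>R f x + b) \<in> Imm A"
proof -
  have fs: "f \<in> smooth_functions A" using f by (simp add: Imm_def)
  have "inj (frechet_derivative ((\<lambda>x. r *\<^sub>R f x + b) \<circ> param c) (at y))"
    if c: "c \<in> A" and y: "y \<in> cimg c" for c y
  proof -
    let ?D = "frechet_derivative (f \<circ> param c) (at y)"
    have "((f \<circ> param c) has_derivative ?D) (at y)"
      using fs c y smooth_atlasD(2)[OF A c]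
      by (intro smooth_on_differentiable[of "cimg c"]) (simp_all add: smooth_functions_def)
    then have "((\<lambda>y. r *\<^sub>R (f \<circ> param c) y + b) has_derivative (\<lambda>v. r *\<^sub>R ?D v + 0)) (at y)"
      by (intro has_derivative_add has_derivative_const has_derivative_scaleR_right)
    then have "frechet_derivative ((\<lambda>x. r *\<^sub>R f x + b) \<circ> param c) (at y) = (\<lambda>v. r *\<^sub>R ?D v)"
      by (intro frechet_derivative_at[symmetric]) (simp add: o_def)
    moreover have "inj ?D" using f c y by (simp add: Imm_def)
    ultimately show ?thesis using r by (simp add: inj_def)
  qed
  moreover have "(\<lambda>x. r *\<^sub>R f x + b) \<in> smooth_functions A"
    by (rule smooth_functions_scale_translate[OF A fs])
  ultimately show ?thesis by (simp add: Imm_def)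
qed

text \<open>Reparametrization does not change the range of \<open>f\<close>. So any representatives of the two
  shapes take their values in the balls of radius \<open>S\<close> around \<open>0\<close> and \<open>l\<close>.\<close>

lemma frechet_dist_translate_ge:
  fixes f :: "'p \<Rightarrow> real^'n::finite"
  assumes f: "f \<in> Imm A" and fl: "(\<lambda>x. f x + l) \<in> Imm A" and S: "\<And>x. norm (f x) \<le> S"
  shows "norm l - 2 * S \<le> frechet_dist A (shape A f) (shape A (\<lambda>x. f x + l))"
  unfolding frechet_dist_def
proof (rule cInf_greatest)
  show "{(SUP x. norm (f0 x - f1 x)) |f0 f1. f0 \<in> Imm A \<and> f1 \<in> Imm A \<and>
      shape A f0 = shape A f \<and> shape A f1 = shape A (\<lambda>x. f x + l)} \<noteq> {}"
    using f fl by blast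
next
  fix s assume "s \<in> {(SUP x. norm (f0 x - f1 x)) |f0 f1. f0 \<in> Imm A \<and> f1 \<in> Imm A \<and>
      shape A f0 = shape A f \<and> shape A f1 = shape A (\<lambda>x. f x + l)}"
  then obtain f0 f1 where s: "s = (SUP x. norm (f0 x - f1 x))" and f01: "f0 \<in> Imm A" "f1 \<in> Imm A"
    and sh: "shape A f0 = shape A f" "shape A f1 = shape A (\<lambda>x. f x + l)" by blast
  have mem: "h \<in> shape A h" for h :: "'p \<Rightarrow> real^'n"
    unfolding shape_def using id_Diff comp_id[of h, symmetric] by blast
  obtain \<phi> \<psi> where \<phi>: "f0 = f \<circ> \<phi>" and \<psi>: "f1 = (\<lambda>x. f x + l) \<circ> \<psi>"
    using mem[of f0] mem[of f1] unfolding sh by (auto simp: shape_def)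
  have "(\<lambda>x. f0 x - f1 x) \<in> smooth_functions A"
    using f01 by (intro smooth_functions_diff A) (auto simp: Imm_def)
  then obtain K where "\<And>x. norm (f0 x - f1 x) \<le> K" using smooth_functions_bounded by blast
  then have bdd: "bdd_above (range (\<lambda>x. norm (f0 x - f1 x)))" by (intro bdd_aboveI2)
  have "norm l \<le> norm (f0 x - f1 x) + norm (f (\<phi> x)) + norm (f (\<psi> x))" for x
  proof -
    have "l = - (f0 x - f1 x) + f (\<phi> x) - f (\<psi> x)" by (simp add: \<phi> \<psi>)
    then show ?thesis by (smt (verit) norm_triangle_ineq norm_triangle_ineq4 norm_minus_cancel)
  qed
  then have "norm l - 2 * S \<le> norm (f0 x - f1 x)" for x
    using S[of "\<phi> x"] S[of "\<psi> x"] by (smt (verit))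
  then show "norm l - 2 * S \<le> s"
    unfolding s using bdd by (meson cSUP_upper2 UNIV_I)
qed

text \<open>The path \<open>t \<mapsto> f + t l\<close> has the constant velocity \<open>l\<close>, and translating an immersion does not
  change its volume. So the speed is bounded by a single Sobolev norm of a constant field.\<close>

lemma shape_dist_translate_le:
  fixes P :: "('p \<Rightarrow> real^'n::finite) \<Rightarrow> ('p \<Rightarrow> real^'n) \<Rightarrow> 'p \<Rightarrow> real^'n"
    and f :: "'p \<Rightarrow> real^'n"
  assumes P: "sobolev_type_operator A P" and f: "f \<in> Imm A"
    and C: "\<And>f h. f \<in> Imm A \<Longrightarrow> h \<in> smooth_functions A \<Longrightarrow> GP_norm A P f h \<le> C * Hp_norm A p f h"
  shows "shape_dist_GP A P (shape A f) (shape A (\<lambda>x. f x + l))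
    \<le> ereal (\<bar>C\<bar> * (norm l * sqrt (2 * measure (vol A f) (space (vol A f)))))"
proof -
  let ?F = "\<lambda>t x. f x + t *\<^sub>R l"
  let ?B = "\<bar>C\<bar> * (norm l * sqrt (2 * measure (vol A f) (space (vol A f))))"
  have fs: "f \<in> smooth_functions A" using f by (simp add: Imm_def)
  have F: "?F t \<in> Imm A" for t using Imm_scale_translate[OF f, of 1 "t *\<^sub>R l"] by simp
  have vol: "vol A (?F t) = vol A f" for t
    using vol_scale_translate[OF cpt A fs, of 1 "t *\<^sub>R l"] by simp
  have path: "is_shape_path A ?F (shape A f) (shape A (\<lambda>x. f x + l))"
    using F smooth_curve_translation[OF A fs] by (simp add: is_shape_path_def)
  have vel: "vector_derivative (\<lambda>s. f x + s *\<^sub>R l) (at t) = l" for x and t :: real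
    by (rule vector_derivative_at) (auto intro!: derivative_eq_intros)
  have "shape_path_length A P ?F \<le> ?B"
  proof (rule shape_path_length_le)
    fix t :: real
    have "quotient_norm A P (?F t) (\<lambda>x. l) \<le> GP_norm A P (?F t) (\<lambda>x. l)"
      by (intro quotient_norm_bounds P F smooth_functions_const A)
    also have "\<dots> \<le> C * Hp_norm A p (?F t) (\<lambda>x. l)"
      by (intro C F smooth_functions_const A)
    also have "\<dots> \<le> \<bar>C\<bar> * \<bar>Hp_norm A p (?F t) (\<lambda>x. l)\<bar>"
      using abs_ge_self[of "C * Hp_norm A p (?F t) (\<lambda>x. l)"] by (simp add: abs_mult)
    also have "\<dots> \<le> ?B"
      using Hp_norm_const_le[OF P F, of p t l] by (intro mult_left_mono) (simp_all add: vol)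
    finally show "quotient_norm A P (?F t) (\<lambda>x. vector_derivative (\<lambda>s. ?F s x) (at t)) \<le> ?B"
      by (simp add: vel)
  qed simp
  then show ?thesis
    unfolding shape_dist_GP_def using path by (intro INF_lower2[of ?F]) auto
qed

lemma shape_dist_GP_nonneg:
  fixes P :: "('p \<Rightarrow> real^'n::finite) \<Rightarrow> ('p \<Rightarrow> real^'n) \<Rightarrow> 'p \<Rightarrow> real^'n"
  assumes "sobolev_type_operator A P"
  shows "0 \<le> shape_dist_GP A P F0 F1"
  unfolding shape_dist_GP_def
  using shape_path_length_nonneg[OF assms] by (intro INF_greatest) auto

end

theorem mainTheorem11:
  fixes A :: "('p::t2_space, 'm::finite) chart set"
    and P :: "('p \<Rightarrow> real^'n::finite) \<Rightarrow> ('p \<Rightarrow> real^'n) \<Rightarrow> 'p \<Rightarrow> real^'n"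
    and p :: real
  assumes "compact (UNIV :: 'p set)" and "connected (UNIV :: 'p set)" and "smooth_atlas A"
    and "(Imm A :: ('p \<Rightarrow> real^'n) set) \<noteq> {}"
    and "sobolev_type_operator A P"
    and "0 \<le> p" and "p < real CARD('m) / 2 + 1"
    and "\<exists>C. \<forall>f\<in>Imm A. \<forall>h\<in>smooth_functions A. GP_norm A P f h \<le> C * Hp_norm A p f h"
  shows "\<not> (\<exists>C'::real. \<forall>F0\<in>shape_space A. \<forall>F1\<in>shape_space A.
              ereal (frechet_dist A F0 F1) \<le> ereal C' * shape_dist_GP A P F0 F1)"
proof
  assume "\<exists>C'::real. \<forall>F0\<in>shape_space A. \<forall>F1\<in>shape_space A.
              ereal (frechet_dist A F0 F1) \<le> ereal C' * shape_dist_GP A P F0 F1"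
  then obtain C' where C': "\<And>F0 F1. F0 \<in> shape_space A \<Longrightarrow> F1 \<in> shape_space A \<Longrightarrow>
      ereal (frechet_dist A F0 F1) \<le> ereal C' * shape_dist_GP A P F0 F1" by blast
  note cpt = assms(1) and A = assms(3) and P = assms(5)
  obtain f :: "'p \<Rightarrow> real^'n" where f: "f \<in> Imm A" using assms(4) by blast
  then have fs: "f \<in> smooth_functions A" by (simp add: Imm_def)
  obtain C where C: "\<And>f h. f \<in> Imm A \<Longrightarrow> h \<in> smooth_functions A \<Longrightarrow> GP_norm A P f h \<le> C * Hp_norm A p f h"
    using assms(8) by blast
  \<comment> \<open>The direction of translation is any unit vector.\<close>
  obtain l :: "real^'n" where l: "norm l = 1" using norm_axis_1 by blast
  obtain S where S: "\<And>x. norm (f x) \<le> S" using smooth_functions_bounded[OF cpt A fs] by blast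
  let ?V = "measure (vol A f) (space (vol A f))"
  have ineq: "1 - 2 * (r * S) \<le> \<bar>C'\<bar> * (\<bar>C\<bar> * sqrt (2 * (r ^ CARD('m) * ?V)))" if r: "0 < r" for r
  proof -
    let ?g = "\<lambda>x. r *\<^sub>R f x"
    let ?d = "shape_dist_GP A P (shape A ?g) (shape A (\<lambda>x. ?g x + l))"
    let ?B = "\<bar>C\<bar> * sqrt (2 * (r ^ CARD('m) * ?V))"
    have g: "(\<lambda>x. ?g x + b) \<in> Imm A" for b
      using Imm_scale_translate[OF cpt A f, of r b] r by simp
    have g0: "?g \<in> Imm A" using g[of 0] by simp
    have "vol A ?g = scale_measure (ennreal (r ^ CARD('m))) (vol A f)"
      using vol_scale_translate[OF cpt A fs, of r 0] r by simp
    then have "measure (vol A ?g) (space (vol A ?g)) = r ^ CARD('m) * ?V"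
      using r by (simp add: space_scale_measure)
    then have d_le: "?d \<le> ereal ?B"
      using shape_dist_translate_le[OF cpt A P g0 C, of l] l by simp
    have d_ge: "0 \<le> ?d" by (rule shape_dist_GP_nonneg[OF cpt A P])
    have "1 - 2 * (r * S) \<le> frechet_dist A (shape A ?g) (shape A (\<lambda>x. ?g x + l))"
      using frechet_dist_translate_ge[OF cpt A g0 g[of l], of "r * S"] l S r
      by (simp add: mult_left_mono)
    then have "ereal (1 - 2 * (r * S)) \<le> ereal (frechet_dist A (shape A ?g) (shape A (\<lambda>x. ?g x + l)))"
      by simp
    also have "\<dots> \<le> ereal C' * ?d"
      using g0 g[of l] by (intro C') (auto simp: shape_space_def)
    also have "\<dots> \<le> ereal \<bar>C'\<bar> * ?d"
      using d_ge by (intro ereal_mult_right_mono) simp_all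
    also have "\<dots> \<le> ereal \<bar>C'\<bar> * ereal ?B"
      using d_le by (intro ereal_mult_left_mono) simp_all
    finally show ?thesis by simp
  qed
  \<comment> \<open>As \<open>r\<close> tends to 0, the inequality becomes \<open>1 \<le> 0\<close>, because \<open>CARD('m) > 0\<close>.\<close>
  let ?R = "\<lambda>r. \<bar>C'\<bar> * (\<bar>C\<bar> * sqrt (2 * (r ^ CARD('m) * ?V)))"
  have "((\<lambda>r. 1 - 2 * (r * S)) \<longlongrightarrow> 1 - 2 * (0 * S)) (at_right 0)"
    by (intro tendsto_intros)
  moreover have "(?R \<longlongrightarrow> ?R 0) (at_right 0)"
    by (intro tendsto_intros)
  moreover have "eventually (\<lambda>r. 1 - 2 * (r * S) \<le> ?R r) (at_right 0)"
    using eventually_at_right_less[of "0::real"] by (rule eventually_mono) (rule ineq)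
  ultimately have "1 - 2 * (0 * S) \<le> ?R 0"
    by (intro tendsto_le[of "at_right 0" ?R _ "\<lambda>r. 1 - 2 * (r * S)"]) simp_all
  then show False by (simp add: power_0_left)
qed

end
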